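(* Let $N\ge 1$, $\frac{2N}{N+1}<p<2$ and $0<q<\frac p2$. Let $u_0\in L^1(\mathbb{R}^N)\cap W^{1,\infty}(\mathbb{R}^N)$ with $u_0\ge 0$ and $u_0\not\equiv 0$, and let $u$ be the solution of the Cauchy problem $$\partial_t u-\Delta_p u+|\nabla u|^q=0 \ \text{ in } (0,\infty)\times\mathbb{R}^N,\qquad u(0)=u_0 \ \text{ in } \mathbb{R}^N.$$ (a) If there is $C_0>0$ such that $u_0(x)\le C_0(1+|x|)^{-q/(1-q)}$ for all $x\in\mathbb{R}^N$, then the extinction time $T_e$ of $u$ is positive and finite. (b) If $\lim_{|x|\to\infty}|x|^{q/(1-q)}u_0(x)=\infty$ and $u_0(x)>0$ for every $x\in\mathbb{R}^N$, then $T_e=\infty$ and $\mathcal{P}(t)=\mathbb{R}^N$ for every $t>0$.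
   Context: $\Delta_p u=\mathrm{div}(|\nabla u|^{p-2}\nabla u)$. For such $p,q,u_0$ the Cauchy problem has a unique non-negative viscosity solution $u$ (viscosity solutions being understood in the sense adapted to the singular $p$-Laplacian, with test functions restricted to the admissible class $\mathcal{A}$ described below), which is also a weak solution; "the solution" refers to it. The admissible class: $\mathcal{F}_p$ is the set of $\xi\in C^2([0,\infty))$ with $\xi(0)=\xi'(0)=\xi''(0)=0$, $\xi''(r)>0$ for $r>0$, and $\lim_{r\to0}|\xi'(r)|^{p-2}\xi''(r)=0$; $\mathcal{A}$ is the set of $\psi\in C^2((0,\infty)\times\mathbb{R}^N)$ such that for every $(t_0,x_0)$ with $\nabla\psi(t_0,x_0)=0$ there exist $\delta>0$, $\xi\in\mathcal{F}_p$ and a continuous $\omega\ge0$ on $[0,\infty)$ with $\omega(t)/t\to0$ as $t\to0$ such that $|\psi(t,x)-\psi(t_0,x_0)-\partial_t\psi(t_0,x_0)(t-t_0)|\le\xi(|x-x_0|)+\omega(|t-t_0|)$ for $(t,x)\in(t_0-\delta,t_0+\delta)\times B_\delta(x_0)$. An upper semicontinuous $u$ is a viscosity subsolution on $(0,T)\times\mathbb{R}^N$ if whenever $\psi\in\mathcal{A}$ and $u-\psi$ has a local maximum at $(t_0,x_0)$, one has $\partial_t\psi\le\Delta_p\psi-|\nabla\psi|^q$ at $(t_0,x_0)$ if $\nabla\psi(t_0,x_0)\ne0$, and $\partial_t\psi(t_0,x_0)\le0$ if $\nabla\psi(t_0,x_0)=0$; a lower semicontinuous $u$ is a viscosity supersolution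 if $-u$ is a viscosity subsolution (equivalently, reversed inequalities at local minima of $u-\psi$); a viscosity solution is a continuous function that is both. Extinction time: $T_e=\sup\{t\ge0: u(t)\not\equiv0\}$. Positivity set: $\mathcal{P}(t)=\{x\in\mathbb{R}^N: u(t,x)>0\}$. *)

theory Defs
  imports "HOL-Analysis.Analysis"
begin

definition usc_on :: "'a::topological_space set \<Rightarrow> ('a \<Rightarrow> real) \<Rightarrow> bool" where
  "usc_on S f \<longleftrightarrow> (\<forall>z\<in>S. \<forall>c. f z < c \<longrightarrow> eventually (\<lambda>w. f w < c) (at z within S))"

definition C2_on :: "(real \<times> (real^'n)) set \<Rightarrow> (real \<Rightarrow> real^'n \<Rightarrow> real) \<Rightarrow> bool" where
  "C2_on U \<psi> \<longleftrightarrow> (\<exists>D1 D2.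
     (\<forall>z\<in>U. ((\<lambda>(t,x). \<psi> t x) has_derivative blinfun_apply (D1 z)) (at z)) \<and>
     (\<forall>z\<in>U. (D1 has_derivative blinfun_apply (D2 z)) (at z)) \<and>
     continuous_on U D2)"

definition time_deriv :: "(real \<Rightarrow> real^'n \<Rightarrow> real) \<Rightarrow> real \<Rightarrow> real^'n \<Rightarrow> real" where
  "time_deriv \<psi> t x = deriv (\<lambda>s. \<psi> s x) t"

definition sgrad :: "(real \<Rightarrow> real^'n \<Rightarrow> real) \<Rightarrow> real \<Rightarrow> real^'n \<Rightarrow> real^'n" where
  "sgrad \<psi> t x = (\<Sum>i\<in>Basis. deriv (\<lambda>h. \<psi> t (x + h *\<^sub>R i)) 0 *\<^sub>R i)"

definition plap :: "real \<Rightarrow> (real \<Rightarrow> real^'n \<Rightarrow> real) \<Rightarrow> real \<Rightarrow> real^'n \<Rightarrow> real" where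
  "plap p \<psi> t x = (\<Sum>i\<in>Basis. deriv (\<lambda>h.
      norm (sgrad \<psi> t (x + h *\<^sub>R i)) powr (p - 2) * (sgrad \<psi> t (x + h *\<^sub>R i) \<bullet> i)) 0)"

definition Fp_class :: "real \<Rightarrow> (real \<Rightarrow> real) set" where
  "Fp_class p = {\<xi>. \<exists>\<xi>1 \<xi>2.
      (\<forall>r\<ge>0. (\<xi> has_real_derivative \<xi>1 r) (at r within {0..})) \<and>
      (\<forall>r\<ge>0. (\<xi>1 has_real_derivative \<xi>2 r) (at r within {0..})) \<and>
      continuous_on {0..} \<xi>2 \<and>
      \<xi> 0 = 0 \<and> \<xi>1 0 = 0 \<and> \<xi>2 0 = 0 \<and>
      (\<forall>r>0. \<xi>2 r > 0) \<and>
      ((\<lambda>r. \<bar>\<xi>1 r\<bar> powr (p - 2) * \<xi>2 r) \<longlongrightarrow> 0) (at_right 0)}"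

definition admissible :: "real \<Rightarrow> (real \<Rightarrow> real^'n \<Rightarrow> real) set" where
  "admissible p = {\<psi>. C2_on ({0<..} \<times> UNIV) \<psi> \<and>
     (\<forall>t0>0. \<forall>x0. sgrad \<psi> t0 x0 = 0 \<longrightarrow>
        (\<exists>\<delta>>0. \<exists>\<xi>\<in>Fp_class p. \<exists>\<omega>::real\<Rightarrow>real.
           continuous_on {0..} \<omega> \<and> (\<forall>s\<ge>0. \<omega> s \<ge> 0) \<and>
           ((\<lambda>s. \<omega> s / s) \<longlongrightarrow> 0) (at_right 0) \<and>
           (\<forall>t x. \<bar>t - t0\<bar> < \<delta> \<and> x \<in> ball x0 \<delta> \<longrightarrow>
              \<bar>\<psi> t x - \<psi> t0 x0 - time_deriv \<psi> t0 x0 * (t - t0)\<bar>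
                \<le> \<xi> (norm (x - x0)) + \<omega> \<bar>t - t0\<bar>)))}"

definition loc_max_at :: "real set \<Rightarrow> (real \<Rightarrow> real^'n \<Rightarrow> real) \<Rightarrow> real \<Rightarrow> real^'n \<Rightarrow> bool" where
  "loc_max_at I f t0 x0 \<longleftrightarrow> (\<exists>e>0. \<forall>t x. t \<in> I \<and> \<bar>t - t0\<bar> < e \<and> norm (x - x0) < e \<longrightarrow> f t x \<le> f t0 x0)"

definition loc_min_at :: "real set \<Rightarrow> (real \<Rightarrow> real^'n \<Rightarrow> real) \<Rightarrow> real \<Rightarrow> real^'n \<Rightarrow> bool" where
  "loc_min_at I f t0 x0 \<longleftrightarrow> (\<exists>e>0. \<forall>t x. t \<in> I \<and> \<bar>t - t0\<bar> < e \<and> norm (x - x0) < e \<longrightarrow> f t x \<ge> f t0 x0)"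

definition visc_subsol :: "real \<Rightarrow> real \<Rightarrow> real set \<Rightarrow> (real \<Rightarrow> real^'n \<Rightarrow> real) \<Rightarrow> bool" where
  "visc_subsol p q I u \<longleftrightarrow> usc_on (I \<times> UNIV) (\<lambda>(t,x). u t x) \<and>
     (\<forall>\<psi>\<in>admissible p. \<forall>t0\<in>I. \<forall>x0.
        loc_max_at I (\<lambda>t x. u t x - \<psi> t x) t0 x0 \<longrightarrow>
        (if sgrad \<psi> t0 x0 \<noteq> 0
         then time_deriv \<psi> t0 x0 \<le> plap p \<psi> t0 x0 - norm (sgrad \<psi> t0 x0) powr q
         else time_deriv \<psi> t0 x0 \<le> 0))"

definition visc_supersol :: "real \<Rightarrow> real \<Rightarrow> real set \<Rightarrow> (real \<Rightarrow> real^'n \<Rightarrow> real) \<Rightarrow> bool" where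
  "visc_supersol p q I u \<longleftrightarrow> usc_on (I \<times> UNIV) (\<lambda>(t,x). - u t x) \<and>
     (\<forall>\<psi>\<in>admissible p. \<forall>t0\<in>I. \<forall>x0.
        loc_min_at I (\<lambda>t x. u t x - \<psi> t x) t0 x0 \<longrightarrow>
        (if sgrad \<psi> t0 x0 \<noteq> 0
         then time_deriv \<psi> t0 x0 \<ge> plap p \<psi> t0 x0 - norm (sgrad \<psi> t0 x0) powr q
         else time_deriv \<psi> t0 x0 \<ge> 0))"

definition visc_sol :: "real \<Rightarrow> real \<Rightarrow> real set \<Rightarrow> (real \<Rightarrow> real^'n \<Rightarrow> real) \<Rightarrow> bool" where
  "visc_sol p q I u \<longleftrightarrow> continuous_on (I \<times> UNIV) (\<lambda>(t,x). u t x) \<and>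
     visc_subsol p q I u \<and> visc_supersol p q I u"

definition cauchy_sol :: "real \<Rightarrow> real \<Rightarrow> (real^'n \<Rightarrow> real) \<Rightarrow> (real \<Rightarrow> real^'n \<Rightarrow> real) \<Rightarrow> bool" where
  "cauchy_sol p q u0 u \<longleftrightarrow> continuous_on ({0..} \<times> UNIV) (\<lambda>(t,x). u t x) \<and>
     (\<forall>t\<ge>0. \<forall>x. u t x \<ge> 0) \<and> (\<forall>x. u 0 x = u0 x) \<and> visc_sol p q {0<..} u"

definition extinction_time :: "(real \<Rightarrow> real^'n \<Rightarrow> real) \<Rightarrow> ereal" where
  "extinction_time u = Sup {ereal t | t. t \<ge> 0 \<and> (\<exists>x. u t x \<noteq> 0)}"

definition positivity_set :: "(real \<Rightarrow> real^'n \<Rightarrow> real) \<Rightarrow> real \<Rightarrow> (real^'n) set" where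
  "positivity_set u t = {x. u t x > 0}"

end

theory Submission
  imports Defs
begin

text \<open>
Every comparison is with an explicit barrier, so no doubling of variables is needed. A barrier
\<open>\<phi> t (l x)\<close>, with \<open>l\<close> planar or \<open>l x = norm (x - x1) ^ (2 * j)\<close> for large \<open>j\<close>, is replaced at a touching
point by a globally admissible function \<open>a * (t - t0) + K * (t - t0)\<^sup>2 + E (l x)\<close>, where \<open>E\<close> is an
exponential whose derivative does not vanish.

Slow decay: \<open>M * (T - t) * (A + norm x ^ (2 * j)) powr (- \<gamma> / (2 * j))\<close>, \<open>\<gamma> = q / (1 - q)\<close>, is a strict
subsolution for \<open>M\<close> and then \<open>A\<close> large, and lies below \<open>u\<close> initially.

Fast decay: barriers blowing up on the boundary of large balls show that \<open>u\<close> tends to 0 at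
infinity, uniformly in bounded time intervals, without any growth condition on \<open>u\<close>. Then \<open>u\<close> lies
below the self-similar \<open>c * (T - t) powr \<alpha> * (norm x * (T - t) powr \<beta> + s1) powr (- \<gamma>)\<close>, which vanishes at
time \<open>T\<close>. This barrier has a concave kink at the origin, and it is touched from above at \<open>x0\<close> by the
plane wave obtained on replacing \<open>norm x\<close> by \<open>x \<bullet> v\<close>, \<open>v = x0 / norm x0\<close>.
\<close>

section \<open>Test functions\<close>

text \<open>The class \<open>admissible p\<close> is a global condition: a test function must be C2
  for all positive times and all x, and very flat at each of its critical points, wherever they lie.
  Barriers with an asymptote, a kink or a terminal time are not of this kind. Contact, however, is
  local, so only the 2-jet of the barrier at the contact point is retained. For E(l x) with E'
  nowhere zero the critical points are those of \<open>l\<close>: none if \<open>l\<close> is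
  planar, only the centre if \<open>l\<close> is a power of the distance. The square of the distance
  is never flat enough, because every member of \<open>Fp_class p\<close> is o(r^2); this forces the
  high even powers.

  The hypothesis q < p / 2 acts through p + (p - 2) * \<gamma> = (p - 2 * q) / (1 - q) > 0. On a
  tail r^(-\<gamma>) the absorption is of order r^(-\<gamma>) as well, because (\<gamma> + 1) * q =
  \<gamma>, while diffusion is smaller by the factor r^(-(p + (p - 2) * \<gamma>)). Since also q <
  1, absorption scales sublinearly in the amplitude: small amplitudes let it beat the time
  derivative (extinction), large ones let the time derivative win (positivity).\<close>

lemma C2_onI:
  fixes \<psi> :: "real \<Rightarrow> real^'n \<Rightarrow> real"
  assumes 1: "\<And>z. z \<in> U \<Longrightarrow> ((\<lambda>(t,x). \<psi> t x) has_derivative (\<lambda>h. h \<bullet> G z)) (at z)"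
    and 2: "\<And>z. z \<in> U \<Longrightarrow> (G has_derivative G' z) (at z)"
    and 3: "\<And>h. continuous_on U (\<lambda>z. G' z h)"
  shows "C2_on U \<psi>"
proof -
  \<comment> \<open>Riesz representation replaces the functional by the gradient field
    \<open>G\<close>. In finite dimension continuity of \<open>D2\<close> can be tested on basis
    vectors, so continuity of \<open>G'\<close> in each fixed direction is enough.\<close>
  define D1 where "D1 = (\<lambda>z. blinfun_inner_left (G z))"
  \<comment> \<open>Off \<open>U\<close> the map \<open>G' z\<close> is not known to be bounded
    linear, hence the default value 0.\<close>
  define D2 where "D2 = (\<lambda>z. if z \<in> U then Blinfun (\<lambda>h. blinfun_inner_left (G' z h)) else 0)"
  have bl: "bounded_linear (\<lambda>h. blinfun_inner_left (G' z h))" if "z \<in> U" for z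
    using bounded_linear_compose[OF bounded_linear_blinfun_inner_left
        has_derivative_bounded_linear[OF 2[OF that]]] .
  have D2: "blinfun_apply (D2 z) h = blinfun_inner_left (G' z h)" if "z \<in> U" for z h
    unfolding D2_def using bl[OF that] that by (simp add: bounded_linear_Blinfun_apply)
  have "((\<lambda>(t,x). \<psi> t x) has_derivative blinfun_apply (D1 z)) (at z)" if "z \<in> U" for z
    using 1[OF that] unfolding D1_def by (simp add: blinfun_inner_left.rep_eq)
  moreover have "(D1 has_derivative blinfun_apply (D2 z)) (at z)" if "z \<in> U" for z
  proof -
    have "(D1 has_derivative (\<lambda>h. blinfun_inner_left (G' z h))) (at z)"
      unfolding D1_def
      by (rule bounded_linear.has_derivative[OF bounded_linear_blinfun_inner_left 2[OF that]])
    moreover have "(\<lambda>h. blinfun_inner_left (G' z h)) = blinfun_apply (D2 z)" using D2[OF that] by (simp add: fun_eq_iff)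
    ultimately show ?thesis by simp
  qed
  moreover have "continuous_on U D2"
  proof (rule continuous_on_blinfun_componentwise)
    fix i :: "real \<times> (real^'n)" assume "i \<in> Basis"
    have "continuous_on U (\<lambda>z. blinfun_inner_left (G' z i))"
      by (rule bounded_linear.continuous_on[OF bounded_linear_blinfun_inner_left 3])
    then show "continuous_on U (\<lambda>z. blinfun_apply (D2 z) i)"
      by (rule continuous_on_eq) (simp add: D2)
  qed
  ultimately show ?thesis unfolding C2_on_def by blast
qed

text \<open>At \<open>y0\<close> the value is 0, the slope \<open>b\<close> and the second
  derivative \<open>b * \<kappa>\<close>, so \<kappa> prescribes the ratio of second to first
  derivative. Since this ratio is constant in y, the flux |E'|^(p-2) E' is again an exponential and
  p-Laplacians come out in closed form.\<close>

definition exp_profile :: "real \<Rightarrow> real \<Rightarrow> real \<Rightarrow> real \<Rightarrow> real" where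
  "exp_profile b \<kappa> y0 y = b / \<kappa> * (exp (\<kappa> * (y - y0)) - 1)"

lemma exp_profile_deriv [derivative_intros]:
  assumes "\<kappa> \<noteq> 0" "(f has_real_derivative f') (at x within S)"
  shows "((\<lambda>x. exp_profile b \<kappa> y0 (f x)) has_real_derivative b * exp (\<kappa> * (f x - y0)) * f') (at x within S)"
  using assms unfolding exp_profile_def
  by (auto intro!: derivative_eq_intros)

lemma exp_profile_has_derivative:
  assumes "\<kappa> \<noteq> 0" "(f has_derivative f') (at x within S)"
  shows "((\<lambda>x. exp_profile b \<kappa> y0 (f x)) has_derivative (\<lambda>h. b * exp (\<kappa> * (f x - y0)) * f' h)) (at x within S)"
  using assms unfolding exp_profile_def
  by (auto intro!: derivative_eq_intros)

text \<open>The coefficient \<open>K\<close> is left free: it absorbs second-order errors in time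
  and changes neither the time derivative at \<open>t0\<close> nor any spatial derivative.\<close>

definition test_fun ::
  "(real^'n \<Rightarrow> real) \<Rightarrow> real \<Rightarrow> real \<Rightarrow> real \<Rightarrow> real \<Rightarrow> real \<Rightarrow> real \<Rightarrow> real \<Rightarrow> real^'n \<Rightarrow> real" where
  "test_fun l a K b \<kappa> t0 y0 t x = a * (t - t0) + K * (t - t0)\<^sup>2 + exp_profile b \<kappa> y0 (l x)"

lemma time_deriv_test_fun: "time_deriv (test_fun l a K b \<kappa> t0 y0) t x = a + 2 * K * (t - t0)"
  unfolding time_deriv_def test_fun_def
  by (rule DERIV_imp_deriv) (auto intro!: derivative_eq_intros)

lemma sgrad_test_fun:
  assumes "\<kappa> \<noteq> 0" and l: "(l has_derivative (\<lambda>h. h \<bullet> g)) (at x)"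
  shows "sgrad (test_fun l a K b \<kappa> t0 y0) t x = (b * exp (\<kappa> * (l x - y0))) *\<^sub>R g"
proof -
  have d: "deriv (\<lambda>h. test_fun l a K b \<kappa> t0 y0 t (x + h *\<^sub>R i)) 0
      = b * exp (\<kappa> * (l x - y0)) * (i \<bullet> g)" for i
  proof -
    have "((\<lambda>h. x + h *\<^sub>R i) has_derivative (\<lambda>h. h *\<^sub>R i)) (at 0)"
      by (auto intro!: derivative_eq_intros)
    moreover have "(l has_derivative (\<lambda>h. h \<bullet> g)) (at (x + 0 *\<^sub>R i))"
      using l by simp
    ultimately have "((\<lambda>h. l (x + h *\<^sub>R i)) has_derivative (\<lambda>h. (h *\<^sub>R i) \<bullet> g)) (at 0)"
      by (rule has_derivative_compose)
    then have "((\<lambda>h. l (x + h *\<^sub>R i)) has_real_derivative (i \<bullet> g)) (at 0)"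
      by (auto simp: has_field_derivative_def elim!: has_derivative_eq_rhs)
    note E = exp_profile_deriv[OF assms(1) this, of b y0]
    have "((\<lambda>h. a * (t - t0) + K * (t - t0)\<^sup>2 + exp_profile b \<kappa> y0 (l (x + h *\<^sub>R i)))
        has_real_derivative 0 + b * exp (\<kappa> * (l (x + 0 *\<^sub>R i) - y0)) * (i \<bullet> g)) (at 0)"
      by (rule DERIV_add[OF DERIV_const E])
    then show ?thesis unfolding test_fun_def by (simp add: DERIV_imp_deriv)
  qed
  have "(\<Sum>i\<in>Basis. (c * (i \<bullet> g)) *\<^sub>R i) = c *\<^sub>R g" for c
  proof -
    have "(\<Sum>i\<in>Basis. (c * (i \<bullet> g)) *\<^sub>R i) = c *\<^sub>R (\<Sum>i\<in>Basis. (g \<bullet> i) *\<^sub>R i)"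
      by (simp only: scaleR_sum_right scaleR_scaleR inner_commute[of g])
    then show ?thesis by (simp add: euclidean_representation)
  qed
  then show ?thesis unfolding sgrad_def d by simp
qed

lemma C2_on_test_fun:
  fixes l :: "real^'n \<Rightarrow> real"
  assumes k: "\<kappa> \<noteq> 0" and l: "\<And>x. (l has_derivative (\<lambda>h. h \<bullet> g x)) (at x)"
    and g: "\<And>x. (g has_derivative g' x) (at x)"
    and cg: "\<And>h. continuous_on UNIV (\<lambda>x. g' x h)"
  shows "C2_on U (test_fun l a K b \<kappa> t0 y0)"
proof (rule C2_onI)
  define e where "e = (\<lambda>x. b * exp (\<kappa> * (l x - y0)))"
  define G where "G = (\<lambda>z::real \<times> (real^'n). (a + 2 * K * (fst z - t0), e (snd z) *\<^sub>R g (snd z)))"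
  define G' where "G' = (\<lambda>(z::real \<times> (real^'n)) h. (2 * K * fst h,
      e (snd z) *\<^sub>R g' (snd z) (snd h) + (\<kappa> * e (snd z) * (snd h \<bullet> g (snd z))) *\<^sub>R g (snd z)))"
  have e: "(e has_derivative (\<lambda>h. \<kappa> * e x * (h \<bullet> g x))) (at x)" for x
    unfolding e_def by (auto intro!: derivative_eq_intros l)
  show "((\<lambda>(t, x). test_fun l a K b \<kappa> t0 y0 t x) has_derivative (\<lambda>h. h \<bullet> G z)) (at z)" for z
  proof -
    have ls: "((\<lambda>z. l (snd z)) has_derivative (\<lambda>h. snd h \<bullet> g (snd z))) (at z)"
      by (rule has_derivative_compose[OF has_derivative_snd[OF has_derivative_ident] l])
    have "((\<lambda>z. a * (fst z - t0) + K * (fst z - t0)\<^sup>2 + exp_profile b \<kappa> y0 (l (snd z)))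
       has_derivative (\<lambda>h. h \<bullet> G z)) (at z)"
      by (rule derivative_eq_intros exp_profile_has_derivative[OF k ls] refl | simp)+
        (auto simp: G_def e_def inner_prod_def algebra_simps)
    then show ?thesis by (simp add: test_fun_def case_prod_unfold)
  qed
  show "(G has_derivative G' z) (at z)" for z
  proof -
    have es: "((\<lambda>z. e (snd z)) has_derivative (\<lambda>h. \<kappa> * e (snd z) * (snd h \<bullet> g (snd z)))) (at z)"
      by (rule has_derivative_compose[OF has_derivative_snd[OF has_derivative_ident] e])
    have gs: "((\<lambda>z. g (snd z)) has_derivative (\<lambda>h. g' (snd z) (snd h))) (at z)"
      by (rule has_derivative_compose[OF has_derivative_snd[OF has_derivative_ident] g])
    show ?thesis unfolding G_def G'_def
      by (rule has_derivative_Pair)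
        (auto intro!: derivative_eq_intros has_derivative_scaleR[OF es gs])
  qed
  have ce: "continuous_on UNIV e"
    by (intro continuous_at_imp_continuous_on ballI has_derivative_continuous[OF e])
  have cgg: "continuous_on UNIV g"
    by (intro continuous_at_imp_continuous_on ballI has_derivative_continuous[OF g])
  have "continuous_on UNIV (\<lambda>x. e x *\<^sub>R g' x v + (\<kappa> * e x * (v \<bullet> g x)) *\<^sub>R g x)" for v
    by (intro continuous_intros ce cgg cg)
  then have c: "continuous_on U (\<lambda>z. e (snd z) *\<^sub>R g' (snd z) v + (\<kappa> * e (snd z) * (v \<bullet> g (snd z))) *\<^sub>R g (snd z))" for v
    by (rule continuous_on_compose2[OF _ continuous_on_snd[OF continuous_on_id]]) auto
  show "continuous_on U (\<lambda>z. G' z h)" for h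
    unfolding G'_def by (intro continuous_on_Pair continuous_on_const c)
qed

text \<open>Each component of the flux is a pure exponential of rate (p - 1) * \<kappa> along
  \<open>v\<close>; its divergence sums the squared components of the unit vector \<open>v\<close>.
  The profile is based at the point of evaluation, so the exponential equals 1 there.\<close>

lemma plap_planar_test_fun:
  fixes v :: "real^'n"
  assumes "\<kappa> \<noteq> 0" "b \<noteq> 0" "norm v = 1"
  shows "plap p (test_fun (\<lambda>x. x \<bullet> v) a K b \<kappa> t0 (x \<bullet> v)) t x = (p - 1) * \<bar>b\<bar> powr (p - 2) * (b * \<kappa>)"
proof -
  let ?y0 = "x \<bullet> v"
  have l: "((\<lambda>x. x \<bullet> v) has_derivative (\<lambda>h. h \<bullet> v)) (at y)" for y :: "real^'n"
    by (auto intro!: derivative_eq_intros)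
  note sg = sgrad_test_fun[OF assms(1) l]
  have d: "deriv (\<lambda>h. norm (sgrad (test_fun (\<lambda>x. x \<bullet> v) a K b \<kappa> t0 ?y0) t (x + h *\<^sub>R i)) powr (p - 2)
      * (sgrad (test_fun (\<lambda>x. x \<bullet> v) a K b \<kappa> t0 ?y0) t (x + h *\<^sub>R i) \<bullet> i)) 0
    = (p - 1) * \<bar>b\<bar> powr (p - 2) * (b * \<kappa>) * (i \<bullet> v)\<^sup>2" for i
  proof (rule DERIV_imp_deriv)
    have e: "norm (sgrad (test_fun (\<lambda>x. x \<bullet> v) a K b \<kappa> t0 ?y0) t (x + h *\<^sub>R i)) powr (p - 2)
      * (sgrad (test_fun (\<lambda>x. x \<bullet> v) a K b \<kappa> t0 ?y0) t (x + h *\<^sub>R i) \<bullet> i)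
      = \<bar>b\<bar> powr (p - 2) * b * (i \<bullet> v) * exp ((p - 1) * (\<kappa> * (h * (i \<bullet> v))))" for h
    proof -
      have "exp (\<kappa> * (h * (i \<bullet> v))) powr (p - 2) * exp (\<kappa> * (h * (i \<bullet> v))) = exp ((p - 1) * (\<kappa> * (h * (i \<bullet> v))))"
        by (simp add: powr_def algebra_simps flip: exp_add)
      then show ?thesis
        unfolding sg by (simp add: assms(3) abs_mult powr_mult inner_add_left inner_commute[of v] mult_ac)
    qed
    show "((\<lambda>h. norm (sgrad (test_fun (\<lambda>x. x \<bullet> v) a K b \<kappa> t0 ?y0) t (x + h *\<^sub>R i)) powr (p - 2)
      * (sgrad (test_fun (\<lambda>x. x \<bullet> v) a K b \<kappa> t0 ?y0) t (x + h *\<^sub>R i) \<bullet> i)) has_real_derivative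
       (p - 1) * \<bar>b\<bar> powr (p - 2) * (b * \<kappa>) * (i \<bullet> v)\<^sup>2) (at 0)"
      unfolding e by (auto intro!: derivative_eq_intros simp: power2_eq_square)
  qed
  have "(\<Sum>i\<in>Basis. (i \<bullet> v)\<^sup>2) = 1"
    using assms(3) euclidean_inner[of v v]
    by (simp add: power2_eq_square inner_commute norm_eq_1)
  then show ?thesis unfolding plap_def d by (simp flip: sum_distrib_left)
qed

text \<open>A plane wave with nowhere vanishing slope has no critical points, so the flatness
  condition is vacuous.\<close>

lemma admissible_planar_test_fun:
  fixes v :: "real^'n"
  assumes "\<kappa> \<noteq> 0" "b \<noteq> 0" "norm v = 1"
  shows "test_fun (\<lambda>x. x \<bullet> v) a K b \<kappa> t0 y0 \<in> admissible p"
proof -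
  have l: "((\<lambda>x. x \<bullet> v) has_derivative (\<lambda>h. h \<bullet> v)) (at y)" for y :: "real^'n"
    by (auto intro!: derivative_eq_intros)
  have "C2_on ({0<..} \<times> UNIV) (test_fun (\<lambda>x. x \<bullet> v) a K b \<kappa> t0 y0)"
    by (rule C2_on_test_fun[OF assms(1) l has_derivative_const]) simp
  moreover have "sgrad (test_fun (\<lambda>x. x \<bullet> v) a K b \<kappa> t0 y0) t x \<noteq> 0" for t x
    unfolding sgrad_test_fun[OF assms(1) l] using assms by auto
  ultimately show ?thesis unfolding admissible_def by simp
qed

section \<open>Radial test functions built on an even power of the distance\<close>

text \<open>For \<xi> = C r^n the quantity |\<xi>'|^(p-2) \<xi>'' is a multiple of r^((n-1)(p-1)-1),
  which tends to 0 exactly when the exponent is positive.\<close>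

lemma Fp_class_power:
  assumes "0 < C" "1 < p" "p < 2" "(real n - 1) * (p - 1) > 1"
  shows "(\<lambda>r. C * r ^ n) \<in> Fp_class p"
proof -
  have n: "real n - 1 > 1"
    using assms by (smt (verit) mult_less_cancel_left2 mult_nonpos_nonneg)
  \<comment> \<open>As p - 1 < 1, the hypothesis forces n \<ge> 3. Writing n = m + 3 makes the
    exponents m + 2 and m + 1 of the two derivatives visibly positive, without truncated
    subtraction.\<close>
  then obtain m where m: "n = m + 3" 
    by (metis add.commute le_Suc_ex less_diff_eq numeral_3_eq_3 not_less_eq_eq not_less of_nat_1 of_nat_Suc of_nat_less_iff one_add_one Suc_1 numeral_2_eq_2)
  define x1 where "x1 = (\<lambda>r. C * real n * r ^ (m + 2))"
  define x2 where "x2 = (\<lambda>r. C * real n * real (m + 2) * r ^ (m + 1))"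
  let ?e = "real (m + 2) * (p - 2) + real (m + 1)"
  have e: "?e > 0" using assms(4) unfolding m by (simp add: algebra_simps)
  have "((\<lambda>r. (C * real n) powr (p - 2) * (C * real n * real (m + 2)) * r powr ?e) \<longlongrightarrow> 
      (C * real n) powr (p - 2) * (C * real n * real (m + 2)) * 0) (at_right 0)"
    by (intro tendsto_intros tendsto_zero_powrI[where b = ?e])
      (use e in \<open>auto simp: eventually_at_filter\<close>)
  moreover have "\<forall>\<^sub>F r in at_right 0. (C * real n) powr (p - 2) * (C * real n * real (m + 2)) * r powr ?e
      = \<bar>x1 r\<bar> powr (p - 2) * x2 r"
    unfolding eventually_at_right_field
  proof (intro exI[of _ 1] conjI allI impI)
    fix r :: real assume r: "0 < r" "r < 1"
    have "\<bar>x1 r\<bar> = (C * real n) * r powr (real (m + 2))"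
      unfolding x1_def using r assms(1) by (subst powr_realpow) auto
    then have "\<bar>x1 r\<bar> powr (p - 2) = (C * real n) powr (p - 2) * r powr (real (m + 2) * (p - 2))"
      using r assms(1) by (simp add: powr_mult powr_powr)
    moreover have "x2 r = C * real n * real (m + 2) * r powr real (m + 1)"
      unfolding x2_def using r by (subst powr_realpow) auto
    ultimately show "(C * real n) powr (p - 2) * (C * real n * real (m + 2)) * r powr ?e
      = \<bar>x1 r\<bar> powr (p - 2) * x2 r" by (simp add: powr_add mult_ac)
  qed simp
  ultimately have "((\<lambda>r. \<bar>x1 r\<bar> powr (p - 2) * x2 r) \<longlongrightarrow> 0) (at_right 0)"
    using Lim_transform_eventually by fastforce
  moreover have "((\<lambda>r. C * r ^ n) has_real_derivative x1 r) (at r within {0..})" for r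
    unfolding x1_def m by (auto intro!: derivative_eq_intros)
  moreover have "(x1 has_real_derivative x2 r) (at r within {0..})" for r
    unfolding x1_def x2_def
    using DERIV_cmult[OF DERIV_pow[of "m + 2" r "{0..}"], of "C * real n"] by (simp add: mult.assoc)
  moreover have "continuous_on {0..} x2" unfolding x2_def by (intro continuous_intros)
  moreover have "x1 0 = 0" "x2 0 = 0" "\<forall>r>0. x2 r > 0" "C * 0 ^ n = 0"
    unfolding x1_def x2_def using assms(1) by (auto simp: m)
  ultimately show ?thesis unfolding Fp_class_def by blast
qed

text \<open>Expressed through the inner product, this power of the distance is a polynomial and
  hence smooth at the centre, where the norm is not differentiable.\<close>

definition rpow :: "nat \<Rightarrow> 'a::real_inner \<Rightarrow> 'a \<Rightarrow> real" where
  "rpow j x1 x = ((x - x1) \<bullet> (x - x1)) ^ j"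

definition rpow_grad :: "nat \<Rightarrow> 'a::real_inner \<Rightarrow> 'a \<Rightarrow> 'a" where
  "rpow_grad j x1 x = (2 * real j * ((x - x1) \<bullet> (x - x1)) ^ (j - 1)) *\<^sub>R (x - x1)"

lemma rpow_has_derivative: "(rpow j x1 has_derivative (\<lambda>h. h \<bullet> rpow_grad j x1 x)) (at x)"
  unfolding rpow_def rpow_grad_def
  by (auto intro!: derivative_eq_intros simp: inner_commute algebra_simps)

lemma C2_on_radial_test_fun:
  fixes x1 :: "real^'n"
  assumes "\<kappa> \<noteq> 0"
  shows "C2_on U (test_fun (rpow j x1) a K b \<kappa> t0 y0)"
proof (rule C2_on_test_fun[OF assms rpow_has_derivative])
  let ?z = "\<lambda>x. (x - x1) \<bullet> (x - x1)"
  let ?g' = "\<lambda>x h. (2 * real j * ?z x ^ (j - 1)) *\<^sub>R h +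
     (2 * real j * (real (j - 1) * (2 * (h \<bullet> (x - x1))) * ?z x ^ (j - 1 - 1))) *\<^sub>R (x - x1)"
  show "(rpow_grad j x1 has_derivative ?g' x) (at x)" for x
    unfolding rpow_grad_def
    by (rule derivative_eq_intros refl | simp)+ (auto simp: inner_commute algebra_simps)
  show "continuous_on UNIV (\<lambda>x. ?g' x h)" for h
    by (intro continuous_intros)
qed

lemma rpow_eq_norm: "rpow j x1 x = norm (x - x1) ^ (2 * j)"
  unfolding rpow_def by (simp add: power_mult dot_square_norm)

text \<open>The centre is the only critical point. There the exponential profile is Lipschitz in
  r^(2j), so the increment is at most C r^(2j) + |K| s^2, and these two terms serve as \<xi> and
  \<omega>.\<close>

lemma admissible_radial_test_fun:
  fixes x1 :: "real^'n"
  assumes k: "\<kappa> \<noteq> 0" and b: "b \<noteq> 0" and p: "1 < p" "p < 2" and j: "(2 * real j - 1) * (p - 1) > 1"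
  shows "test_fun (rpow j x1) a K b \<kappa> t0 y0 \<in> admissible p"
proof -
  let ?f = "test_fun (rpow j x1) a K b \<kappa> t0 y0"
  have j0: "j > 0" using j p by (cases j) auto
  have j1: "real (2 * j) - 1 = 2 * real j - 1" by simp
  have "\<exists>\<delta>>0. \<exists>\<xi>\<in>Fp_class p. \<exists>\<omega>::real\<Rightarrow>real.
           continuous_on {0..} \<omega> \<and> (\<forall>s\<ge>0. \<omega> s \<ge> 0) \<and>
           ((\<lambda>s. \<omega> s / s) \<longlongrightarrow> 0) (at_right 0) \<and>
           (\<forall>t x. \<bar>t - s0\<bar> < \<delta> \<and> x \<in> ball x0 \<delta> \<longrightarrow>
              \<bar>?f t x - ?f s0 x0 - time_deriv ?f s0 x0 * (t - s0)\<bar>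
                \<le> \<xi> (norm (x - x0)) + \<omega> \<bar>t - s0\<bar>)"
    if "sgrad ?f s0 x0 = 0" for s0 x0
  proof -
    have x0: "x0 = x1"
      using that b j0 unfolding sgrad_test_fun[OF k rpow_has_derivative] by (auto simp: rpow_grad_def)
    \<comment> \<open>\<open>C\<close> bounds the slope of the profile on [0,1]; the radius \<delta>
      = 1 chosen below keeps \<open>rpow\<close> in that interval.\<close>
    define C where "C = \<bar>b\<bar> * exp (\<bar>\<kappa>\<bar> * (1 + \<bar>y0\<bar>))"
    have C: "C > 0" unfolding C_def using b by auto
    have bd: "\<bar>exp_profile b \<kappa> y0 y - exp_profile b \<kappa> y0 0\<bar> \<le> C * y" if "0 \<le> y" "y \<le> 1" for y
    proof -
      have "norm (exp_profile b \<kappa> y0 y - exp_profile b \<kappa> y0 0) \<le> C * norm (y - 0)"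
      proof (rule field_differentiable_bound[of "{0..1}"])
        fix z :: real assume z: "z \<in> {0..1}"
        show "((\<lambda>y. exp_profile b \<kappa> y0 y) has_field_derivative b * exp (\<kappa> * (z - y0)) * 1) (at z within {0..1})"
          by (intro exp_profile_deriv k DERIV_ident)
        have "\<kappa> * (z - y0) \<le> \<bar>\<kappa>\<bar> * \<bar>z - y0\<bar>" by (metis abs_ge_self abs_mult)
        also have "\<dots> \<le> \<bar>\<kappa>\<bar> * (1 + \<bar>y0\<bar>)" using z by (intro mult_left_mono) auto
        finally show "norm (b * exp (\<kappa> * (z - y0)) * 1) \<le> C"
          unfolding C_def by (simp add: abs_mult mult_left_mono)
      qed (use that in auto)
      then show ?thesis using that by simp
    qed
    show ?thesis
    proof (intro exI[of _ 1] conjI bexI[of _ "\<lambda>r. C * r ^ (2 * j)"] exI[of _ "\<lambda>s. \<bar>K\<bar> * s\<^sup>2"] allI impI)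
      show "(\<lambda>r. C * r ^ (2 * j)) \<in> Fp_class p"
        by (rule Fp_class_power) (use C p j in auto)
      have "((\<lambda>s. \<bar>K\<bar> * s) \<longlongrightarrow> \<bar>K\<bar> * 0) (at_right 0)" by (intro tendsto_intros)
      moreover have "\<forall>\<^sub>F s in at_right 0. \<bar>K\<bar> * s = \<bar>K\<bar> * s\<^sup>2 / s"
        unfolding eventually_at_right_field by (auto simp: power2_eq_square intro!: exI[of _ 1])
      ultimately show "((\<lambda>s. \<bar>K\<bar> * s\<^sup>2 / s) \<longlongrightarrow> 0) (at_right 0)"
        using Lim_transform_eventually by fastforce
      fix t x assume tx: "\<bar>t - s0\<bar> < 1 \<and> x \<in> ball x0 1"
      let ?r = "rpow j x1 x"
      have r: "0 \<le> ?r" "?r \<le> 1" unfolding rpow_eq_norm using tx x0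
        by (auto intro!: power_le_one simp: dist_norm norm_minus_commute)
      have r0: "rpow j x1 x1 = 0" unfolding rpow_def using j0 by simp
      have "?f t x - ?f s0 x0 - time_deriv ?f s0 x0 * (t - s0)
         = K * (t - s0)\<^sup>2 + (exp_profile b \<kappa> y0 ?r - exp_profile b \<kappa> y0 0)"
        unfolding time_deriv_test_fun unfolding test_fun_def x0 r0
        by (simp add: power2_eq_square algebra_simps)
      also have "\<bar>\<dots>\<bar> \<le> \<bar>K * (t - s0)\<^sup>2\<bar> + C * ?r"
        using bd[OF r] by linarith
      finally show "\<bar>?f t x - ?f s0 x0 - time_deriv ?f s0 x0 * (t - s0)\<bar>
         \<le> C * norm (x - x0) ^ (2 * j) + \<bar>K\<bar> * \<bar>t - s0\<bar>\<^sup>2"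
        unfolding rpow_eq_norm x0 by (simp add: abs_mult)
    qed (auto intro!: continuous_intros)
  qed
  then show ?thesis unfolding admissible_def using C2_on_radial_test_fun[OF k] by blast
qed

lemma norm_sgrad_radial:
  fixes x1 :: "real^'n"
  assumes "\<kappa> \<noteq> 0"
  shows "norm (sgrad (test_fun (rpow j x1) a K b \<kappa> t0 (rpow j x1 x)) t x)
     = 2 * real j * \<bar>b\<bar> * norm (x - x1) ^ (2 * (j - 1) + 1)"
  unfolding sgrad_test_fun[OF assms rpow_has_derivative]
  by (simp add: rpow_grad_def abs_mult power_abs dot_square_norm power_mult)

text \<open>With z = |x - x1|^2 the flux has the form B(z) (x - x1), whose divergence is 2 z B'(z) +
  N B(z), N being the dimension. Here B is an exponential times z^(\<mu>/2), so 2 z B'/B gives the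
  \<kappa>-term plus \<mu>.\<close>

lemma plap_radial_test_fun:
  fixes x1 :: "real^'n" and p :: real
  assumes k: "\<kappa> \<noteq> 0" and b: "b \<noteq> 0" and j: "j > 0" and x: "x \<noteq> x1"
  defines "\<mu> \<equiv> (2 * real j - 1) * (p - 1) - 1"
  shows "plap p (test_fun (rpow j x1) a K b \<kappa> t0 (rpow j x1 x)) t x
     = sgn b * (2 * real j * \<bar>b\<bar>) powr (p - 1) * norm (x - x1) powr \<mu>
        * (2 * real j * (p - 1) * \<kappa> * rpow j x1 x + \<mu> + real CARD('n))"
proof -
  define y0 where "y0 = rpow j x1 x"
  let ?f = "test_fun (rpow j x1) a K b \<kappa> t0 y0"
  let ?z = "\<lambda>y. (y - x1) \<bullet> (y - x1)"
  define c where "c = sgn b * (2 * real j * \<bar>b\<bar>) powr (p - 1)"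
  define B where "B = (\<lambda>z. c * exp ((p - 1) * (\<kappa> * (z ^ j - y0))) * z powr (\<mu> / 2))"
  have field: "norm (sgrad ?f t y) powr (p - 2) * (sgrad ?f t y \<bullet> i) = B (?z y) * ((y - x1) \<bullet> i)"
    if y: "y \<noteq> x1" for y i
  proof -
    let ?e = "exp (\<kappa> * (rpow j x1 y - y0))"
    let ?n = "norm (y - x1)"
    define A where "A = (2 * real j * \<bar>b\<bar>) * ?e * ?z y ^ (j - 1)"
    have z: "?z y > 0" using y by simp
    have A: "A > 0" unfolding A_def using b j z by (intro mult_pos_pos zero_less_power) auto
    have sg: "sgrad ?f t y = (sgn b * A) *\<^sub>R (y - x1)"
      unfolding sgrad_test_fun[OF k rpow_has_derivative] rpow_grad_def A_def
      by (auto simp: sgn_if mult_ac)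
    have n: "norm (sgrad ?f t y) = A * ?z y powr (1/2)"
    proof -
      have "norm (sgrad ?f t y) = A * norm (y - x1)"
        unfolding sg using A b by (simp add: abs_mult abs_sgn_eq)
      then show ?thesis by (simp add: powr_half_sqrt norm_eq_sqrt_inner)
    qed
    have "norm (sgrad ?f t y) powr (p - 2) * (sgn b * A) = sgn b * (A powr (p - 2) * A) * ?z y powr ((p - 2) / 2)"
      unfolding n using A z by (simp add: powr_mult powr_powr mult_ac)
    also have "A powr (p - 2) * A = A powr (p - 1)"
      using A powr_add[of A "p - 2" 1] by simp
    also have "A powr (p - 1) = (2 * real j * \<bar>b\<bar>) powr (p - 1) * exp ((p - 1) * (\<kappa> * (rpow j x1 y - y0)))
         * ?z y powr ((real j - 1) * (p - 1))"
    proof -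
      have "?z y ^ (j - 1) = ?z y powr (real j - 1)"
        using z j by (subst powr_realpow[symmetric]) (auto simp: of_nat_diff)
      moreover have "?e powr (p - 1) = exp ((p - 1) * (\<kappa> * (rpow j x1 y - y0)))"
        by (simp add: powr_def)
      ultimately show ?thesis unfolding A_def by (simp add: powr_mult powr_powr)
    qed
    also have "sgn b * (\<dots>) * ?z y powr ((p - 2) / 2) = B (?z y)"
    proof -
      have "?z y powr ((real j - 1) * (p - 1)) * ?z y powr ((p - 2) / 2) = ?z y powr (\<mu> / 2)"
        unfolding powr_add[symmetric] \<mu>_def by (simp add: field_simps)
      then show ?thesis unfolding B_def c_def rpow_def by (simp add: mult.assoc)
    qed
    finally show ?thesis unfolding sg by (simp add: mult.assoc[symmetric])
  qed
  have z0: "?z x > 0" using x by simp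
  define B' where "B' = B (?z x) * ((p - 1) * \<kappa> * (real j * ?z x ^ (j - 1)) + \<mu> / 2 / ?z x)"
  have Bd: "(B has_real_derivative B') (at (?z x))"
  proof -
    have "?z x powr (\<mu> / 2 - 1) = ?z x powr (\<mu> / 2) / ?z x"
      using z0 by (simp add: powr_diff)
    then show ?thesis unfolding B_def B'_def using z0
      by (auto intro!: derivative_eq_intros simp: field_simps)
  qed
  have d: "deriv (\<lambda>h. norm (sgrad ?f t (x + h *\<^sub>R i)) powr (p - 2) * (sgrad ?f t (x + h *\<^sub>R i) \<bullet> i)) 0
     = B' * 2 * ((x - x1) \<bullet> i)\<^sup>2 + B (?z x)" if i: "i \<in> Basis" for i
  proof (rule DERIV_imp_deriv)
    have zd: "((\<lambda>h. ?z (x + h *\<^sub>R i)) has_real_derivative 2 * ((x - x1) \<bullet> i)) (at 0)"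
    proof -
      have "?z (x + h *\<^sub>R i) = ?z x + 2 * h * ((x - x1) \<bullet> i) + h\<^sup>2" for h
        using i by (simp add: inner_simps inner_commute power2_eq_square algebra_simps)
      then show ?thesis by (auto intro!: derivative_eq_intros)
    qed
    have "((\<lambda>h. B (?z (x + h *\<^sub>R i))) has_real_derivative B' * (2 * ((x - x1) \<bullet> i))) (at 0)"
      by (rule DERIV_chain'[OF zd]) (use Bd in simp)
    moreover have "((\<lambda>h. (x + h *\<^sub>R i - x1) \<bullet> i) has_real_derivative 1) (at 0)"
      using i by (auto intro!: derivative_eq_intros simp: inner_simps)
    ultimately have "((\<lambda>h. B (?z (x + h *\<^sub>R i)) * ((x + h *\<^sub>R i - x1) \<bullet> i)) has_real_derivative
        B' * (2 * ((x - x1) \<bullet> i)) * ((x + 0 *\<^sub>R i - x1) \<bullet> i) + 1 * B (?z (x + 0 *\<^sub>R i))) (at 0)"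
      by (rule DERIV_mult)
    then have D: "((\<lambda>h. B (?z (x + h *\<^sub>R i)) * ((x + h *\<^sub>R i - x1) \<bullet> i)) has_real_derivative
        B' * 2 * ((x - x1) \<bullet> i)\<^sup>2 + B (?z x)) (at 0)"
      by (simp add: power2_eq_square mult_ac)
    \<comment> \<open>\<open>field\<close> is available off the centre only; for small
      \<open>h\<close> the point stays away from \<open>x1\<close>, which suffices for a derivative
      at 0.\<close>
    have "continuous (at 0) (\<lambda>h. x + h *\<^sub>R i)" by (intro continuous_intros)
    then have "((\<lambda>h. x + h *\<^sub>R i) \<longlongrightarrow> x) (at 0)" by (simp add: continuous_at)
    then have "\<forall>\<^sub>F h in at 0. x + h *\<^sub>R i \<noteq> x1"
      using x by (rule tendsto_imp_eventually_ne)
    then have ev: "\<forall>\<^sub>F h in nhds 0. x + h *\<^sub>R i \<noteq> x1"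
      using x by (simp add: eventually_nhds_conv_at)
    show "((\<lambda>h. norm (sgrad ?f t (x + h *\<^sub>R i)) powr (p - 2) * (sgrad ?f t (x + h *\<^sub>R i) \<bullet> i))
       has_real_derivative B' * 2 * ((x - x1) \<bullet> i)\<^sup>2 + B (?z x)) (at 0)"
    proof (rule DERIV_cong_ev[THEN iffD2, OF refl _ refl D])
      show "\<forall>\<^sub>F h in nhds 0. norm (sgrad ?f t (x + h *\<^sub>R i)) powr (p - 2) * (sgrad ?f t (x + h *\<^sub>R i) \<bullet> i)
         = B (?z (x + h *\<^sub>R i)) * ((x + h *\<^sub>R i - x1) \<bullet> i)"
        using ev by eventually_elim (rule field)
    qed
  qed
  have s: "(\<Sum>i\<in>Basis. ((x - x1) \<bullet> i)\<^sup>2) = ?z x"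
    by (subst euclidean_inner) (simp add: power2_eq_square)
  have "plap p ?f t x = (\<Sum>i\<in>(Basis::(real^'n) set). B' * 2 * ((x - x1) \<bullet> i)\<^sup>2 + B (?z x))"
    unfolding plap_def by (rule sum.cong[OF refl d])
  also have "\<dots> = B' * 2 * ?z x + real CARD('n) * B (?z x)"
    by (simp add: sum.distrib s flip: sum_distrib_left)
  also have "\<dots> = B (?z x) * (2 * real j * (p - 1) * \<kappa> * ?z x ^ j + \<mu> + real CARD('n))"
  proof -
    have "?z x ^ (j - 1) * ?z x = ?z x ^ j" using j by (metis power_minus_mult)
    then have "B' * 2 * ?z x = B (?z x) * (2 * real j * (p - 1) * \<kappa> * ?z x ^ j + \<mu>)"
      unfolding B'_def using z0 by (simp add: field_simps)
    then show ?thesis by (simp add: algebra_simps)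
  qed
  also have "B (?z x) = c * norm (x - x1) powr \<mu>"
  proof -
    have "?z x powr (\<mu> / 2) = norm (x - x1) powr \<mu>"
      using x by (simp add: dot_square_norm powr_powr flip: powr_numeral)
    then show ?thesis unfolding B_def y0_def rpow_def by simp
  qed
  finally show ?thesis unfolding c_def y0_def rpow_def[of j x1 x] by (simp add: mult_ac)
qed

section \<open>Touching by barriers\<close>

text \<open>Here \<open>a\<close>, \<open>b\<close>, \<open>X\<close> are the first time derivative
  and the first two space derivatives. Differentiability of the time derivative at the base point
  stands in for mixed second derivatives: it yields the Lipschitz bound that controls the mixed
  increment.\<close>

definition has_jet :: "(real \<Rightarrow> real \<Rightarrow> real) \<Rightarrow> real \<Rightarrow> real \<Rightarrow> real \<Rightarrow> real \<Rightarrow> real \<Rightarrow> bool" where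
  "has_jet \<phi> t0 y0 a b X \<longleftrightarrow> (\<exists>\<phi>t \<phi>y. \<exists>d>0.
     (\<forall>t y. \<bar>t - t0\<bar> < d \<longrightarrow> \<bar>y - y0\<bar> < d \<longrightarrow> ((\<lambda>t. \<phi> t y) has_real_derivative \<phi>t t y) (at t)) \<and>
     (\<lambda>(t,y). \<phi>t t y) differentiable (at (t0, y0)) \<and> \<phi>t t0 y0 = a \<and>
     (\<forall>y. \<bar>y - y0\<bar> < d \<longrightarrow> (\<phi> t0 has_real_derivative \<phi>y y) (at y)) \<and>
     (\<phi>y has_real_derivative X) (at y0) \<and> \<phi>y y0 = b)"

lemma has_jet_uminus:
  assumes "has_jet \<phi> t0 y0 a b X"
  shows "has_jet (\<lambda>t y. - \<phi> t y) t0 y0 (- a) (- b) (- X)"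
proof -
  obtain \<phi>t \<phi>y d where *: "d > 0"
    "\<And>t y. \<bar>t - t0\<bar> < d \<Longrightarrow> \<bar>y - y0\<bar> < d \<Longrightarrow> ((\<lambda>t. \<phi> t y) has_real_derivative \<phi>t t y) (at t)"
    "(\<lambda>(t,y). \<phi>t t y) differentiable (at (t0, y0))" "\<phi>t t0 y0 = a"
    "\<And>y. \<bar>y - y0\<bar> < d \<Longrightarrow> (\<phi> t0 has_real_derivative \<phi>y y) (at y)"
    "(\<phi>y has_real_derivative X) (at y0)" "\<phi>y y0 = b"
    using assms unfolding has_jet_def by blast
  have "(\<lambda>z. - (case z of (t,y) \<Rightarrow> \<phi>t t y)) differentiable (at (t0, y0))"
    using *(3) by (rule differentiable_minus)
  then have "(\<lambda>(t,y). - \<phi>t t y) differentiable (at (t0, y0))"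
    by (simp add: case_prod_unfold)
  with * show ?thesis
    unfolding has_jet_def
    by (intro exI[of _ "\<lambda>t y. - \<phi>t t y"] exI[of _ "\<lambda>y. - \<phi>y y"] exI[of _ d])
      (auto intro!: DERIV_minus)
qed

text \<open>As \<open>g1\<close> is differentiable only at \<open>y0\<close>, the argument uses its
  sign on either side of \<open>y0\<close> and the mean value theorem instead of a Taylor
  expansion.\<close>

lemma second_derivative_neg_local_max:
  fixes g g1 :: "real \<Rightarrow> real"
  assumes d: "0 < d" and g: "\<And>y. \<bar>y - y0\<bar> < d \<Longrightarrow> (g has_real_derivative g1 y) (at y)"
    and g1: "(g1 has_real_derivative X) (at y0)" "g1 y0 = 0" and X: "X < 0"
  shows "\<exists>e>0. \<forall>y. \<bar>y - y0\<bar> < e \<longrightarrow> g y \<le> g y0"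
proof -
  obtain d1 where d1: "d1 > 0" "\<And>h. 0 < h \<Longrightarrow> h < d1 \<Longrightarrow> g1 (y0 + h) < 0"
    using DERIV_neg_dec_right[OF g1(1) X] g1(2) by auto
  obtain d2 where d2: "d2 > 0" "\<And>h. 0 < h \<Longrightarrow> h < d2 \<Longrightarrow> g1 (y0 - h) > 0"
    using DERIV_neg_dec_left[OF g1(1) X] g1(2) by auto
  define e where "e = Min {d, d1, d2}"
  have e: "e > 0" "e \<le> d" "e \<le> d1" "e \<le> d2" unfolding e_def using d d1 d2 by auto
  have "g y \<le> g y0" if y: "\<bar>y - y0\<bar> < e" for y
  proof (cases y y0 rule: linorder_cases)
    case less
    then obtain z where z: "y < z" "z < y0" "g y0 - g y = (y0 - y) * g1 z"
      using MVT2[OF less, of g g1] g y e by (auto simp: abs_if split: if_splits)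
    have "g1 z > 0" using d2(2)[of "y0 - z"] z y e by auto
    then have "(y0 - y) * g1 z > 0" using less by simp
    then show ?thesis using z by simp
  next
    case greater
    then obtain z where z: "y0 < z" "z < y" "g y - g y0 = (y - y0) * g1 z"
      using MVT2[OF greater, of g g1] g y e by (auto simp: abs_if split: if_splits)
    have "g1 z < 0" using d1(2)[of "z - y0"] z y e by auto
    then have "(y - y0) * g1 z < 0" using greater by (simp add: mult_pos_neg)
    then show ?thesis using z by simp
  qed simp
  then show ?thesis using e by blast
qed

lemma differentiable_local_lipschitz:
  assumes "f differentiable (at z)"
  shows "\<exists>C>0. \<exists>d>0. \<forall>w. norm (w - z) < d \<longrightarrow> norm (f w - f z) \<le> C * norm (w - z)"
proof -
  obtain f' where f': "(f has_derivative f') (at z)" using assms unfolding differentiable_def by blast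
  obtain B where B: "B > 0" "\<And>x. norm (f' x) \<le> norm x * B"
    using bounded_linear.pos_bounded[OF has_derivative_bounded_linear[OF f']] by blast
  obtain d where d: "d > 0" "\<And>w. norm (w - z) < d \<Longrightarrow> norm (f w - f z - f' (w - z)) \<le> 1 * norm (w - z)"
    using f' unfolding has_derivative_at_alt by (meson zero_less_one)
  have "norm (f w - f z) \<le> (B + 1) * norm (w - z)" if "norm (w - z) < d" for w
    using d(2)[OF that] B(2)[of "w - z"] norm_triangle_sub[of "f w - f z" "f' (w - z)"]
    by (simp add: algebra_simps)
  then show ?thesis using B d by (intro exI[of _ "B + 1"]) auto
qed

text \<open>The mixed increment is absorbed by Young's inequality, at the price of a strictly larger
  second derivative \<open>b * \<kappa>\<close> and of the constant \<open>K\<close>.\<close>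

lemma has_jet_upper:
  assumes jet: "has_jet \<phi> t0 y0 a b X" and \<kappa>: "\<kappa> \<noteq> 0" and X: "X < b * \<kappa>"
  shows "\<exists>K. \<exists>d>0. \<forall>t y. \<bar>t - t0\<bar> < d \<longrightarrow> \<bar>y - y0\<bar> < d \<longrightarrow>
    \<phi> t y \<le> \<phi> t0 y0 + a * (t - t0) + K * (t - t0)\<^sup>2 + exp_profile b \<kappa> y0 y"
proof -
  obtain \<phi>t \<phi>y d where d: "d > 0"
    and dt: "\<And>t y. \<bar>t - t0\<bar> < d \<Longrightarrow> \<bar>y - y0\<bar> < d \<Longrightarrow> ((\<lambda>t. \<phi> t y) has_real_derivative \<phi>t t y) (at t)"
    and lip: "(\<lambda>(t,y). \<phi>t t y) differentiable (at (t0, y0))" and a: "\<phi>t t0 y0 = a"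
    and dy: "\<And>y. \<bar>y - y0\<bar> < d \<Longrightarrow> (\<phi> t0 has_real_derivative \<phi>y y) (at y)"
    and dyy: "(\<phi>y has_real_derivative X) (at y0)" and b: "\<phi>y y0 = b"
    using jet unfolding has_jet_def by blast
  \<comment> \<open>Half of the gap between \<open>b * \<kappa>\<close> and \<open>X\<close>. One
    half keeps \<open>g\<close> below strictly concave at \<open>y0\<close>; the other is the
    reserve \<eta> / 2 * (y - y0)^2 that pays for the mixed increment.\<close>
  define \<eta> where "\<eta> = (b * \<kappa> - X) / 2"
  have \<eta>: "\<eta> > 0" unfolding \<eta>_def using X by simp
  define g where "g = (\<lambda>y. \<phi> t0 y + \<eta> / 2 * (y - y0)\<^sup>2 - exp_profile b \<kappa> y0 y)"
  define g1 where "g1 = (\<lambda>y. \<phi>y y + \<eta> * (y - y0) - b * exp (\<kappa> * (y - y0)) * 1)"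
  have "\<exists>e>0. \<forall>y. \<bar>y - y0\<bar> < e \<longrightarrow> g y \<le> g y0"
  proof (rule second_derivative_neg_local_max[OF d])
    show "(g has_real_derivative g1 y) (at y)" if "\<bar>y - y0\<bar> < d" for y
      unfolding g_def g1_def
      by (rule DERIV_diff[OF DERIV_add[OF dy[OF that]] exp_profile_deriv[OF \<kappa> DERIV_ident]])
        (auto intro!: derivative_eq_intros)
    show "(g1 has_real_derivative (X + \<eta> - b * \<kappa>)) (at y0)"
      unfolding g1_def by (auto intro!: derivative_eq_intros dyy)
    show "g1 y0 = 0" unfolding g1_def b by simp
    show "X + \<eta> - b * \<kappa> < 0" using \<eta> unfolding \<eta>_def by (simp add: field_simps)
  qed
  then obtain e where e: "e > 0" "\<And>y. \<bar>y - y0\<bar> < e \<Longrightarrow> g y \<le> g y0" by blast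
  have gy0: "g y0 = \<phi> t0 y0" unfolding g_def exp_profile_def by simp
  obtain C r where C: "C > 0" "r > 0"
    and Cr: "\<And>w. norm (w - (t0, y0)) < r \<Longrightarrow>
      norm ((\<lambda>(t,y). \<phi>t t y) w - \<phi>t t0 y0) \<le> C * norm (w - (t0, y0))"
    using differentiable_local_lipschitz[OF lip] by auto
  have np: "norm ((s, y) - (t0, y0)) \<le> \<bar>s - t0\<bar> + \<bar>y - y0\<bar>" for s y
    by (simp add: norm_Pair sqrt_sum_squares_le_sum_abs)
  have \<phi>tb: "\<bar>\<phi>t s y - a\<bar> \<le> C * (\<bar>s - t0\<bar> + \<bar>y - y0\<bar>)" if "\<bar>s - t0\<bar> < r / 2" "\<bar>y - y0\<bar> < r / 2" for s y
  proof -
    have "\<bar>\<phi>t s y - a\<bar> \<le> C * norm ((s, y) - (t0, y0))"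
      using Cr[of "(s, y)"] np[of s y] that a by simp
    also have "\<dots> \<le> C * (\<bar>s - t0\<bar> + \<bar>y - y0\<bar>)" using np C by (intro mult_left_mono) auto
    finally show ?thesis .
  qed
  define K where "K = C + C\<^sup>2 / (2 * \<eta>)"
  define \<delta> where "\<delta> = Min {d, e, r / 2}"
  have \<delta>: "\<delta> > 0" "\<delta> \<le> d" "\<delta> \<le> e" "\<delta> \<le> r / 2" unfolding \<delta>_def using d e C by auto
  have "\<phi> t y \<le> \<phi> t0 y0 + a * (t - t0) + K * (t - t0)\<^sup>2 + exp_profile b \<kappa> y0 y"
    if t: "\<bar>t - t0\<bar> < \<delta>" and y: "\<bar>y - y0\<bar> < \<delta>" for t y
  proof -
    \<comment> \<open>The mean value theorem is applied in time at fixed \<open>y\<close>; the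
      difference between the intermediate time derivative and \<open>a\<close> is then bounded by
      the Lipschitz estimate at the base point.\<close>
    have "\<exists>s. \<bar>s - t0\<bar> \<le> \<bar>t - t0\<bar> \<and> \<phi> t y - \<phi> t0 y = (t - t0) * \<phi>t s y"
    proof (cases t t0 rule: linorder_cases)
      case less
      obtain s where "t < s" "s < t0" "\<phi> t0 y - \<phi> t y = (t0 - t) * \<phi>t s y"
        using MVT2[OF less, of "\<lambda>t. \<phi> t y" "\<lambda>t. \<phi>t t y"] dt t y \<delta> less by (auto simp: abs_if split: if_splits)
      then show ?thesis by (intro exI[of _ s]) (auto simp: algebra_simps)
    next
      case greater
      obtain s where "t0 < s" "s < t" "\<phi> t y - \<phi> t0 y = (t - t0) * \<phi>t s y"
        using MVT2[OF greater, of "\<lambda>t. \<phi> t y" "\<lambda>t. \<phi>t t y"] dt t y \<delta> greater by (auto simp: abs_if split: if_splits)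
      then show ?thesis by (intro exI[of _ s]) auto
    qed auto
    then obtain s where s: "\<bar>s - t0\<bar> \<le> \<bar>t - t0\<bar>" "\<phi> t y - \<phi> t0 y = (t - t0) * \<phi>t s y" by blast
    define T where "T = \<bar>t - t0\<bar>"
    define Y where "Y = \<bar>y - y0\<bar>"
    have "(t - t0) * \<phi>t s y - a * (t - t0) = (t - t0) * (\<phi>t s y - a)" by (simp add: algebra_simps)
    also have "\<dots> \<le> T * \<bar>\<phi>t s y - a\<bar>" unfolding T_def by (metis abs_ge_self abs_mult)
    also have "\<dots> \<le> T * (C * (T + Y))"
    proof (intro mult_left_mono)
      have "\<bar>\<phi>t s y - a\<bar> \<le> C * (\<bar>s - t0\<bar> + \<bar>y - y0\<bar>)" using \<phi>tb s t y \<delta> by simp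
      also have "\<dots> \<le> C * (T + Y)" unfolding T_def Y_def using s C by (intro mult_left_mono) auto
      finally show "\<bar>\<phi>t s y - a\<bar> \<le> C * (T + Y)" .
    qed (simp add: T_def)
    also have "\<dots> \<le> K * T\<^sup>2 + \<eta> / 2 * Y\<^sup>2"
    proof -
      have "0 \<le> (C * T - \<eta> * Y)\<^sup>2 / (2 * \<eta>)" using \<eta> by simp
      also have "(C * T - \<eta> * Y)\<^sup>2 / (2 * \<eta>) = C\<^sup>2 / (2 * \<eta>) * T\<^sup>2 + \<eta> / 2 * Y\<^sup>2 - C * T * Y"
        using \<eta> by (simp add: power2_eq_square field_simps)
      finally show ?thesis unfolding K_def by (simp add: algebra_simps power2_eq_square)
    qed
    also have "\<dots> = K * (t - t0)\<^sup>2 + \<eta> / 2 * (y - y0)\<^sup>2" unfolding T_def Y_def by simp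
    finally have "\<phi> t y \<le> \<phi> t0 y + a * (t - t0) + K * (t - t0)\<^sup>2 + \<eta> / 2 * (y - y0)\<^sup>2"
      using s by linarith
    moreover have "\<phi> t0 y + \<eta> / 2 * (y - y0)\<^sup>2 - exp_profile b \<kappa> y0 y \<le> \<phi> t0 y0"
      using e(2)[of y] y \<delta> gy0 unfolding g_def by simp
    ultimately show ?thesis by linarith
  qed
  then show ?thesis using \<delta>(1) by blast
qed

lemma has_jet_lower:
  assumes jet: "has_jet \<phi> t0 y0 a b X" and \<kappa>: "\<kappa> \<noteq> 0" and X: "b * \<kappa> < X"
  shows "\<exists>K. \<exists>d>0. \<forall>t y. \<bar>t - t0\<bar> < d \<longrightarrow> \<bar>y - y0\<bar> < d \<longrightarrow>
    \<phi> t y \<ge> \<phi> t0 y0 + a * (t - t0) + K * (t - t0)\<^sup>2 + exp_profile b \<kappa> y0 y"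
proof -
  obtain K d where "d > 0" and *: "\<And>t y. \<bar>t - t0\<bar> < d \<Longrightarrow> \<bar>y - y0\<bar> < d \<Longrightarrow>
    - \<phi> t y \<le> - \<phi> t0 y0 + - a * (t - t0) + K * (t - t0)\<^sup>2 + exp_profile (- b) \<kappa> y0 y"
    using has_jet_upper[OF has_jet_uminus[OF jet] \<kappa>] X by auto
  have "\<phi> t0 y0 + a * (t - t0) + - K * (t - t0)\<^sup>2 + exp_profile b \<kappa> y0 y \<le> \<phi> t y"
    if "\<bar>t - t0\<bar> < d" "\<bar>y - y0\<bar> < d" for t y
    using *[OF that] unfolding exp_profile_def by simp
  then show ?thesis using \<open>d > 0\<close> by blast
qed

lemma local_pullback:
  fixes l :: "real^'n \<Rightarrow> real"
  assumes "isCont l x0" "0 < d"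
  shows "\<exists>e>0. e \<le> d \<and> (\<forall>x. norm (x - x0) < e \<longrightarrow> \<bar>l x - l x0\<bar> < d)"
proof -
  obtain e where "e > 0" "\<And>x. dist x x0 < e \<Longrightarrow> dist (l x) (l x0) < d"
    using assms unfolding continuous_at_eps_delta by blast
  then show ?thesis by (intro exI[of _ "min e d"]) (use assms in \<open>auto simp: dist_norm\<close>)
qed

lemma test_fun_at_base: "test_fun l a K b \<kappa> t0 (l x0) t0 x0 = 0"
  unfolding test_fun_def exp_profile_def by simp

section \<open>Viscosity inequalities at a contact point\<close>

text \<open>Near the contact point the test function, shifted by a constant, lies above the barrier
  and agrees with it at that point, so the local maximum passes from u - \<phi> to u minus the test
  function. Admissibility is asked for every \<open>K\<close> because the suitable \<open>K\<close>
  is found only in the proof.\<close>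

lemma subsol_touching:
  fixes l :: "real^'n \<Rightarrow> real"
  assumes sub: "visc_subsol p q {0<..} u" and t0: "0 < t0"
    and jet: "has_jet \<phi> t0 (l x0) a b X" and \<kappa>: "\<kappa> \<noteq> 0" and X: "X < b * \<kappa>"
    and l: "isCont l x0" and adm: "\<And>K. test_fun l a K b \<kappa> t0 (l x0) \<in> admissible p"
    and max: "loc_max_at {0<..} (\<lambda>t x. u t x - \<phi> t (l x)) t0 x0"
  shows "\<exists>K. if sgrad (test_fun l a K b \<kappa> t0 (l x0)) t0 x0 \<noteq> 0
         then a \<le> plap p (test_fun l a K b \<kappa> t0 (l x0)) t0 x0 - norm (sgrad (test_fun l a K b \<kappa> t0 (l x0)) t0 x0) powr q
         else a \<le> 0"
proof -
  obtain K d where d: "d > 0" and up: "\<And>t y. \<bar>t - t0\<bar> < d \<Longrightarrow> \<bar>y - l x0\<bar> < d \<Longrightarrow>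
    \<phi> t y \<le> \<phi> t0 (l x0) + a * (t - t0) + K * (t - t0)\<^sup>2 + exp_profile b \<kappa> (l x0) y"
    using has_jet_upper[OF jet \<kappa> X] by blast
  obtain e where e: "e > 0" "e \<le> d" "\<And>x. norm (x - x0) < e \<Longrightarrow> \<bar>l x - l x0\<bar> < d"
    using local_pullback[OF l d] by blast
  obtain m where m: "m > 0" "\<And>t x. t \<in> {0<..} \<and> \<bar>t - t0\<bar> < m \<and> norm (x - x0) < m \<Longrightarrow>
     u t x - \<phi> t (l x) \<le> u t0 x0 - \<phi> t0 (l x0)"
    using max unfolding loc_max_at_def by blast
  let ?\<psi> = "test_fun l a K b \<kappa> t0 (l x0)"
  have "u t x - ?\<psi> t x \<le> u t0 x0 - ?\<psi> t0 x0"
    if "t \<in> {0<..} \<and> \<bar>t - t0\<bar> < min e m \<and> norm (x - x0) < min e m" for t x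
    using up[of t "l x"] e m(2)[of t x] that unfolding test_fun_at_base unfolding test_fun_def by fastforce
  then have "loc_max_at {0<..} (\<lambda>t x. u t x - ?\<psi> t x) t0 x0"
    unfolding loc_max_at_def using e m by (intro exI[of _ "min e m"]) auto
  note sub[unfolded visc_subsol_def, THEN conjunct2, rule_format, OF adm[of K] _ this, OF greaterThan_iff[THEN iffD2, OF t0]]
  moreover have "time_deriv ?\<psi> t0 x0 = a" by (simp add: time_deriv_test_fun)
  ultimately show ?thesis
    by (intro exI[of _ K]) (simp only:)
qed

lemma supersol_touching:
  fixes l :: "real^'n \<Rightarrow> real"
  assumes sup: "visc_supersol p q {0<..} u" and t0: "0 < t0"
    and jet: "has_jet \<phi> t0 (l x0) a b X" and \<kappa>: "\<kappa> \<noteq> 0" and X: "b * \<kappa> < X"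
    and l: "isCont l x0" and adm: "\<And>K. test_fun l a K b \<kappa> t0 (l x0) \<in> admissible p"
    and min: "loc_min_at {0<..} (\<lambda>t x. u t x - \<phi> t (l x)) t0 x0"
  shows "\<exists>K. if sgrad (test_fun l a K b \<kappa> t0 (l x0)) t0 x0 \<noteq> 0
         then a \<ge> plap p (test_fun l a K b \<kappa> t0 (l x0)) t0 x0 - norm (sgrad (test_fun l a K b \<kappa> t0 (l x0)) t0 x0) powr q
         else a \<ge> 0"
proof -
  obtain K d where d: "d > 0" and up: "\<And>t y. \<bar>t - t0\<bar> < d \<Longrightarrow> \<bar>y - l x0\<bar> < d \<Longrightarrow>
    \<phi> t y \<ge> \<phi> t0 (l x0) + a * (t - t0) + K * (t - t0)\<^sup>2 + exp_profile b \<kappa> (l x0) y"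
    using has_jet_lower[OF jet \<kappa> X] by blast
  obtain e where e: "e > 0" "e \<le> d" "\<And>x. norm (x - x0) < e \<Longrightarrow> \<bar>l x - l x0\<bar> < d"
    using local_pullback[OF l d] by blast
  obtain m where m: "m > 0" "\<And>t x. t \<in> {0<..} \<and> \<bar>t - t0\<bar> < m \<and> norm (x - x0) < m \<Longrightarrow>
     u t x - \<phi> t (l x) \<ge> u t0 x0 - \<phi> t0 (l x0)"
    using min unfolding loc_min_at_def by blast
  let ?\<psi> = "test_fun l a K b \<kappa> t0 (l x0)"
  have "u t x - ?\<psi> t x \<ge> u t0 x0 - ?\<psi> t0 x0"
    if "t \<in> {0<..} \<and> \<bar>t - t0\<bar> < min e m \<and> norm (x - x0) < min e m" for t x
    using up[of t "l x"] e m(2)[of t x] that unfolding test_fun_at_base unfolding test_fun_def by fastforce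
  then have "loc_min_at {0<..} (\<lambda>t x. u t x - ?\<psi> t x) t0 x0"
    unfolding loc_min_at_def using e m by (intro exI[of _ "min e m"]) auto
  note sup[unfolded visc_supersol_def, THEN conjunct2, rule_format, OF adm[of K] _ this, OF greaterThan_iff[THEN iffD2, OF t0]]
  moreover have "time_deriv ?\<psi> t0 x0 = a" by (simp add: time_deriv_test_fun)
  ultimately show ?thesis
    by (intro exI[of _ K]) (simp only:)
qed

text \<open>Touching requires \<open>b * \<kappa>\<close> strictly beyond \<open>X\<close> and
  \<kappa> nonzero, whereas the inequality wanted is the one with \<kappa> = X / b. It is affine in
  \<kappa>, so it survives the limit b * \<kappa> = X + \<epsilon> with \<epsilon> decreasing to
  0.\<close>

lemma affine_limit:
  fixes a A B b X :: real
  assumes b: "b \<noteq> 0" and le: "\<And>\<kappa>. \<kappa> \<noteq> 0 \<Longrightarrow> X < b * \<kappa> \<Longrightarrow> a \<le> A * \<kappa> + B"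
  shows "a \<le> A * (X / b) + B"
proof (rule tendsto_lowerbound)
  have "((\<lambda>\<epsilon>. A * ((X + \<epsilon>) / b) + B) \<longlongrightarrow> A * ((X + 0) / b) + B) (at_right 0)"
    using b by (intro tendsto_intros)
  then show "((\<lambda>\<epsilon>. A * ((X + \<epsilon>) / b) + B) \<longlongrightarrow> A * (X / b) + B) (at_right 0)" by simp
  \<comment> \<open>The value \<epsilon> = - X would give \<kappa> = 0, where the profile
    degenerates.\<close>
  have "\<forall>\<^sub>F \<epsilon> in at_right (0::real). \<epsilon> \<noteq> - X"
    by (rule eventually_neq_at_within)
  then have "\<forall>\<^sub>F \<epsilon> in at_right 0. X + \<epsilon> \<noteq> 0 \<and> \<epsilon> > 0"
    using eventually_at_right_less[of "0::real"] by eventually_elim auto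
  then show "\<forall>\<^sub>F \<epsilon> in at_right 0. a \<le> A * ((X + \<epsilon>) / b) + B"
    by eventually_elim (rule le; use b in auto)
qed simp

lemma isCont_rpow: "isCont (rpow j x1) x"
  using has_derivative_continuous[OF rpow_has_derivative] .

text \<open>Along a plane wave the equation reduces to its one-dimensional form, with no
  dimension-dependent term: the exact p-Laplacian is linear in \<kappa>, and the limit \<kappa> = X
  / b turns \<open>b * \<kappa>\<close> into \<open>X\<close>.\<close>

lemma subsol_planar:
  fixes v :: "real^'n"
  assumes sub: "visc_subsol p q {0<..} u" and t0: "0 < t0" and v: "norm v = 1"
    and jet: "has_jet \<phi> t0 (x0 \<bullet> v) a b X" and b: "b \<noteq> 0"
    and max: "loc_max_at {0<..} (\<lambda>t x. u t x - \<phi> t (x \<bullet> v)) t0 x0"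
  shows "a \<le> (p - 1) * \<bar>b\<bar> powr (p - 2) * X - \<bar>b\<bar> powr q"
proof -
  have "a \<le> ((p - 1) * \<bar>b\<bar> powr (p - 2) * b) * (X / b) + - (\<bar>b\<bar> powr q)"
  proof (rule affine_limit[OF b])
    fix \<kappa> assume \<kappa>: "\<kappa> \<noteq> 0" "X < b * \<kappa>"
    have l: "((\<lambda>x. x \<bullet> v) has_derivative (\<lambda>h. h \<bullet> v)) (at x0)"
      by (auto intro!: derivative_eq_intros)
    have "\<exists>K. if sgrad (test_fun (\<lambda>x. x \<bullet> v) a K b \<kappa> t0 (x0 \<bullet> v)) t0 x0 \<noteq> 0
         then a \<le> plap p (test_fun (\<lambda>x. x \<bullet> v) a K b \<kappa> t0 (x0 \<bullet> v)) t0 x0 - norm (sgrad (test_fun (\<lambda>x. x \<bullet> v) a K b \<kappa> t0 (x0 \<bullet> v)) t0 x0) powr q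
         else a \<le> 0"
      by (rule subsol_touching[OF sub t0 _ \<kappa> _ _ max])
        (use jet b v \<kappa> in \<open>auto intro!: admissible_planar_test_fun continuous_intros\<close>)
    moreover have "v \<noteq> 0" using v by auto
    ultimately show "a \<le> ((p - 1) * \<bar>b\<bar> powr (p - 2) * b) * \<kappa> + - (\<bar>b\<bar> powr q)"
      unfolding sgrad_test_fun[OF \<kappa>(1) l] plap_planar_test_fun[OF \<kappa>(1) b v]
      using b v by (simp add: abs_mult mult.assoc)
  qed
  then show ?thesis using b by simp
qed

text \<open>The condition on \<open>j\<close> places r^(2j) in \<open>Fp_class p\<close>;
  equivalently \<mu>, the power of r in the p-Laplacian of a profile in r^(2j), is positive.\<close>

locale radial_profile =
  fixes p :: real and j :: nat
  assumes p1: "1 < p" and p2: "p < 2" and j: "(2 * real j - 1) * (p - 1) > 1"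
begin

definition \<mu> :: real where "\<mu> = (2 * real j - 1) * (p - 1) - 1"

lemma \<mu>_pos: "\<mu> > 0" using j unfolding \<mu>_def by simp

lemma j_pos: "j > 0" using j p1 by (cases j) auto

lemma sgrad_radial_nonzero:
  fixes x1 :: "real^'n"
  assumes "\<kappa> \<noteq> 0" "b \<noteq> 0"
  shows "sgrad (test_fun (rpow j x1) a K b \<kappa> t0 (rpow j x1 x0)) t x0 \<noteq> 0 \<longleftrightarrow> x0 \<noteq> x1"
  using norm_sgrad_radial[OF assms(1), of j x1 a K b t0 x0 t] assms j_pos
  by (metis (no_types, opaque_lifting) abs_zero abs_eq_0 mult_eq_0_iff norm_eq_zero of_nat_eq_0_iff
      power_eq_0_iff right_minus_eq less_numeral_extra(3) add_gr_0 zero_neq_numeral zero_less_one)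

text \<open>At the centre the gradient of the test function vanishes whatever \<open>b\<close> is,
  so only the sign condition on \<open>a\<close> remains; elsewhere the explicit p-Laplacian is used
  in the limit \<kappa> = X / b.\<close>

lemma subsol_radial:
  fixes x1 :: "real^'n"
  assumes sub: "visc_subsol p q {0<..} u" and t0: "0 < t0"
    and jet: "has_jet \<phi> t0 (rpow j x1 x0) a b X" and b: "b \<noteq> 0"
    and max: "loc_max_at {0<..} (\<lambda>t x. u t x - \<phi> t (rpow j x1 x)) t0 x0"
  shows "if x0 = x1 then a \<le> 0 else a \<le> sgn b * (2 * real j * \<bar>b\<bar>) powr (p - 1) * norm (x0 - x1) powr \<mu>
        * (2 * real j * (p - 1) * (X / b) * rpow j x1 x0 + \<mu> + real CARD('n))
        - (2 * real j * \<bar>b\<bar> * norm (x0 - x1) ^ (2 * (j - 1) + 1)) powr q"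
proof -
  have *: "\<exists>K. if x0 \<noteq> x1
         then a \<le> plap p (test_fun (rpow j x1) a K b \<kappa> t0 (rpow j x1 x0)) t0 x0
             - (2 * real j * \<bar>b\<bar> * norm (x0 - x1) ^ (2 * (j - 1) + 1)) powr q
         else a \<le> 0" if \<kappa>: "\<kappa> \<noteq> 0" "X < b * \<kappa>" for \<kappa>
    using subsol_touching[OF sub t0 jet \<kappa> isCont_rpow admissible_radial_test_fun[OF \<kappa>(1) b p1 p2 j] max]
    unfolding sgrad_radial_nonzero[OF \<kappa>(1) b] norm_sgrad_radial[OF \<kappa>(1)] .
  show ?thesis
  proof (cases "x0 = x1")
    case True
    \<comment> \<open>\<kappa> drops out at the centre, so any nonzero value with b * \<kappa> > X
      serves.\<close>
    define \<kappa> where "\<kappa> = (\<bar>X\<bar> + 1) / b"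
    have "\<kappa> \<noteq> 0" "X < b * \<kappa>" unfolding \<kappa>_def using b by auto
    from *[OF this] True show ?thesis by simp
  next
    case False
    define c where "c = sgn b * (2 * real j * \<bar>b\<bar>) powr (p - 1) * norm (x0 - x1) powr \<mu>"
    have "a \<le> (c * 2 * real j * (p - 1) * rpow j x1 x0) * (X / b) + (c * (\<mu> + real CARD('n))
        - (2 * real j * \<bar>b\<bar> * norm (x0 - x1) ^ (2 * (j - 1) + 1)) powr q)"
    proof (rule affine_limit[OF b])
      fix \<kappa> assume \<kappa>: "\<kappa> \<noteq> 0" "X < b * \<kappa>"
      show "a \<le> (c * 2 * real j * (p - 1) * rpow j x1 x0) * \<kappa> + (c * (\<mu> + real CARD('n))
        - (2 * real j * \<bar>b\<bar> * norm (x0 - x1) ^ (2 * (j - 1) + 1)) powr q)"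
        using *[OF \<kappa>] False unfolding plap_radial_test_fun[OF \<kappa>(1) b j_pos False] \<mu>_def[symmetric]
          c_def[symmetric] by (simp add: algebra_simps)
    qed
    then show ?thesis using False unfolding c_def[symmetric] by (simp add: algebra_simps)
  qed
qed

lemma supersol_radial:
  fixes x1 :: "real^'n"
  assumes sup: "visc_supersol p q {0<..} u" and t0: "0 < t0"
    and jet: "has_jet \<phi> t0 (rpow j x1 x0) a b X" and b: "b \<noteq> 0"
    and min: "loc_min_at {0<..} (\<lambda>t x. u t x - \<phi> t (rpow j x1 x)) t0 x0"
  shows "if x0 = x1 then a \<ge> 0 else a \<ge> sgn b * (2 * real j * \<bar>b\<bar>) powr (p - 1) * norm (x0 - x1) powr \<mu>
        * (2 * real j * (p - 1) * (X / b) * rpow j x1 x0 + \<mu> + real CARD('n))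
        - (2 * real j * \<bar>b\<bar> * norm (x0 - x1) ^ (2 * (j - 1) + 1)) powr q"
proof -
  have *: "\<exists>K. if x0 \<noteq> x1
         then a \<ge> plap p (test_fun (rpow j x1) a K b \<kappa> t0 (rpow j x1 x0)) t0 x0
             - (2 * real j * \<bar>b\<bar> * norm (x0 - x1) ^ (2 * (j - 1) + 1)) powr q
         else a \<ge> 0" if \<kappa>: "\<kappa> \<noteq> 0" "b * \<kappa> < X" for \<kappa>
    using supersol_touching[OF sup t0 jet \<kappa> isCont_rpow admissible_radial_test_fun[OF \<kappa>(1) b p1 p2 j] min]
    unfolding sgrad_radial_nonzero[OF \<kappa>(1) b] norm_sgrad_radial[OF \<kappa>(1)] .
  show ?thesis
  proof (cases "x0 = x1")
    case True
    define \<kappa> where "\<kappa> = - (\<bar>X\<bar> + 1) / b"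
    have "\<kappa> \<noteq> 0" "b * \<kappa> < X" unfolding \<kappa>_def using b by auto
    from *[OF this] True show ?thesis by simp
  next
    case False
    define c where "c = sgn b * (2 * real j * \<bar>b\<bar>) powr (p - 1) * norm (x0 - x1) powr \<mu>"
    \<comment> \<open>All signs are reversed so that \<open>affine_limit\<close> applies to -b and
      -X; their quotient is still X / b.\<close>
    have "- a \<le> - (c * 2 * real j * (p - 1) * rpow j x1 x0) * (- X / - b) + - (c * (\<mu> + real CARD('n))
        - (2 * real j * \<bar>b\<bar> * norm (x0 - x1) ^ (2 * (j - 1) + 1)) powr q)"
    proof (rule affine_limit)
      fix \<kappa> assume \<kappa>: "\<kappa> \<noteq> 0" "- X < - b * \<kappa>"
      then have \<kappa>': "b * \<kappa> < X" by simp
      show "- a \<le> - (c * 2 * real j * (p - 1) * rpow j x1 x0) * \<kappa> + - (c * (\<mu> + real CARD('n))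
        - (2 * real j * \<bar>b\<bar> * norm (x0 - x1) ^ (2 * (j - 1) + 1)) powr q)"
        using *[OF \<kappa>(1) \<kappa>'] False unfolding plap_radial_test_fun[OF \<kappa>(1) b j_pos False] \<mu>_def[symmetric]
          c_def[symmetric] by (simp add: algebra_simps)
    qed (use b in simp)
    then show ?thesis using False unfolding c_def[symmetric] by (simp add: algebra_simps)
  qed
qed

end

section \<open>Positivity for slowly decaying data\<close>

lemma has_jet_decaying:
  fixes A M T s :: real
  assumes Y: "0 < A + y0"
  shows "has_jet (\<lambda>t y. M * (T - t) * (A + y) powr (- s)) t0 y0
    (- M * (A + y0) powr (- s)) (- s * (M * (T - t0)) * (A + y0) powr (- s - 1))
    (s * (s + 1) * (M * (T - t0)) * (A + y0) powr (- s - 2))"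
  unfolding has_jet_def
proof (intro exI[of _ "\<lambda>t y. - M * (A + y) powr (- s)"]
    exI[of _ "\<lambda>y. - s * (M * (T - t0)) * (A + y) powr (- s - 1)"] exI[of _ "A + y0"] conjI allI impI)
  show "(\<lambda>(t::real, y). - M * (A + y) powr - s) differentiable at (t0, y0)"
    unfolding differentiable_def case_prod_unfold
    by (rule exI) (use Y in \<open>auto intro!: derivative_eq_intros\<close>)
  show "((\<lambda>t. M * (T - t) * (A + y) powr - s) has_real_derivative - M * (A + y) powr - s) (at t)" for t y
    by (auto intro!: derivative_eq_intros)
  show "((\<lambda>y. M * (T - t0) * (A + y) powr - s) has_real_derivative
      - s * (M * (T - t0)) * (A + y) powr (- s - 1)) (at y)" if "\<bar>y - y0\<bar> < A + y0" for y
  proof -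
    have "A + y > 0" using that by (auto simp: abs_if split: if_splits)
    then show ?thesis by (auto intro!: derivative_eq_intros DERIV_fun_powr)
  qed
  show "((\<lambda>y. - s * (M * (T - t0)) * (A + y) powr (- s - 1)) has_real_derivative
      s * (s + 1) * (M * (T - t0)) * (A + y0) powr (- s - 2)) (at y0)"
  proof -
    have "((\<lambda>y. (A + y) powr (- s - 1)) has_real_derivative (- s - 1) * (A + y0) powr (- s - 1 - real 1) * 1) (at y0)"
      using Y by (intro DERIV_fun_powr) (auto intro!: derivative_eq_intros)
    from DERIV_cmult[OF this, of "- s * (M * (T - t0))"] show ?thesis
      by (simp add: algebra_simps)
  qed
qed (use Y in auto)

text \<open>Outside a large ball \<open>w\<close> is at least one of its own values, taken inside.
  The radius is enlarged to contain \<open>x1\<close>, so the minimum over the compact cylinder is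
  global on the strip.\<close>

lemma continuous_attains_inf_time_space:
  fixes w :: "real \<Rightarrow> real^'n \<Rightarrow> real"
  assumes cont: "continuous_on ({0..T} \<times> UNIV) (\<lambda>(t,x). w t x)"
    and far: "\<And>t x. 0 \<le> t \<Longrightarrow> t \<le> T \<Longrightarrow> \<rho> < norm x \<Longrightarrow> w t1 x1 \<le> w t x"
    and t1: "0 \<le> t1" "t1 \<le> T"
  obtains t0 x0 where "0 \<le> t0" "t0 \<le> T" "\<And>t x. 0 \<le> t \<Longrightarrow> t \<le> T \<Longrightarrow> w t0 x0 \<le> w t x"
proof -
  define S where "S = {0..T} \<times> cball (0::real^'n) (max \<rho> (norm x1))"
  have S: "compact S" "S \<noteq> {}" unfolding S_def using t1 by (auto intro!: compact_Times)
  have "continuous_on S (\<lambda>(t,x). w t x)"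
    by (rule continuous_on_subset[OF cont]) (auto simp: S_def)
  from continuous_attains_inf[OF S this] obtain z where z: "z \<in> S"
    "\<And>y. y \<in> S \<Longrightarrow> (\<lambda>(t,x). w t x) z \<le> (\<lambda>(t,x). w t x) y" by blast
  obtain t0 x0 where tx: "z = (t0, x0)" by (cases z)
  have 1: "(t1, x1) \<in> S" unfolding S_def using t1 by auto
  have "w t0 x0 \<le> w t x" if "0 \<le> t" "t \<le> T" for t x
  proof (cases "norm x \<le> max \<rho> (norm x1)")
    case True
    then show ?thesis using z(2)[of "(t, x)"] that by (auto simp: S_def tx)
  next
    case False
    then have "w t1 x1 \<le> w t x" using far[of t x] that by auto
    then show ?thesis using z(2)[OF 1] by (simp add: tx)
  qed
  then show ?thesis using that[of t0 x0] z(1) by (auto simp: S_def tx)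
qed

text \<open>Used to trade powers of r = |x| for powers of A + r^(2j) or of L.\<close>

lemma powr_le_base:
  fixes Y :: real
  assumes "0 < j" "0 \<le> r" "r ^ (2 * j) \<le> Y" "0 \<le> c" "0 < Y"
  shows "r powr c \<le> Y powr (c / (2 * real j))"
proof (cases "r = 0")
  case False
  then have r: "r > 0" using assms by simp
  have "r powr c = (r ^ (2 * j)) powr (c / (2 * real j))"
    using r assms(1) by (simp add: powr_powr flip: powr_realpow)
  also have "\<dots> \<le> Y powr (c / (2 * real j))"
    using assms by (intro powr_mono2) auto
  finally show ?thesis .
qed (use assms in auto)

context radial_profile
begin

text \<open>The barrier \<open>M * (T - t) * (A + norm x ^ (2 * j)) powr (- \<gamma> / (2 * j))\<close> has the critical tail
  for which time derivative and absorption scale alike in \<open>x\<close>; as \<open>2 * q < p\<close>, diffusion is of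
  lower order for large \<open>A\<close>.\<close>

lemma decaying_strict_subsolution:
  fixes M T A q r y Y F N :: real
  assumes q: "0 < q" "q < 1" and N: "0 \<le> N"
  defines "\<gamma> \<equiv> q / (1 - q)"
  defines "\<delta> \<equiv> (p + (p - 2) * \<gamma>) / (2 * real j)"
  defines "s \<equiv> \<gamma> / (2 * real j)"
  assumes M: "0 < M" and F: "0 < F" "F \<le> M * T" and A: "0 < A" and \<delta>: "0 < \<delta>"
    and Mq: "(\<gamma> * (M * T)) powr q \<le> M / 2"
    and Ap: "(\<gamma> * (M * T)) powr (p - 1) * (\<mu> + N) * A powr (- \<delta>) < M / 2"
    and r: "0 < r" and Y: "Y = A + r ^ (2 * j)"
  defines "b \<equiv> - s * F * Y powr (- s - 1)"
  defines "X \<equiv> s * (s + 1) * F * Y powr (- s - 2)"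
  shows "- M * Y powr (- s) < sgn b * (2 * real j * \<bar>b\<bar>) powr (p - 1) * r powr \<mu>
      * (2 * real j * (p - 1) * (X / b) * r ^ (2 * j) + \<mu> + N)
      - (2 * real j * \<bar>b\<bar> * r ^ (2 * (j - 1) + 1)) powr q"
proof -
  have \<gamma>: "\<gamma> > 0" unfolding \<gamma>_def using q by simp
  have s: "s > 0" unfolding s_def using \<gamma> j_pos by simp
  have Yp: "Y > 0" "Y \<ge> A" "r ^ (2 * j) \<le> Y" unfolding Y using A r by (auto intro: add_pos_nonneg)
  have b: "b < 0" "\<bar>b\<bar> = s * F * Y powr (- s - 1)" unfolding b_def using s F Yp by (auto simp: abs_mult)
  have js: "2 * real j * \<bar>b\<bar> = \<gamma> * F * Y powr (- s - 1)"
    unfolding b using j_pos unfolding s_def by simp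
  have Xb: "X / b \<le> 0" unfolding X_def using b s F by (simp add: divide_nonneg_neg)
  define G where "G = (\<gamma> * (M * T)) powr (p - 1)"
  define H where "H = (\<gamma> * (M * T)) powr q"
  have jb: "2 * real j * \<bar>b\<bar> \<le> \<gamma> * (M * T) * Y powr (- s - 1)"
    unfolding js using \<gamma> F by (intro mult_right_mono mult_left_mono) auto
  have MT: "M * T > 0" using F by simp
  have e1: "(2 * real j * \<bar>b\<bar>) powr (p - 1) \<le> G * Y powr ((- s - 1) * (p - 1))"
  proof -
    have "(2 * real j * \<bar>b\<bar>) powr (p - 1) \<le> (\<gamma> * (M * T) * Y powr (- s - 1)) powr (p - 1)"
      using jb p1 by (intro powr_mono2) auto
    then show ?thesis unfolding G_def using \<gamma> MT by (simp add: powr_mult powr_powr)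
  qed
  have e2: "r powr \<mu> \<le> Y powr (\<mu> / (2 * real j))"
    using powr_le_base[OF j_pos _ Yp(3) _ Yp(1)] r \<mu>_pos by simp
  have e3: "(2 * real j * \<bar>b\<bar> * r ^ (2 * (j - 1) + 1)) powr q \<le> H * Y powr (- s)"
  proof -
    have jj: "real (2 * (j - 1) + 1) = 2 * real j - 1" using j_pos by (simp add: of_nat_diff)
    have "r ^ (2 * (j - 1) + 1) = r powr (2 * real j - 1)"
      by (subst jj[symmetric], rule powr_realpow[OF r, symmetric])
    also have "\<dots> \<le> Y powr ((2 * real j - 1) / (2 * real j))"
      using powr_le_base[OF j_pos _ Yp(3) _ Yp(1)] r j_pos by simp
    finally have "2 * real j * \<bar>b\<bar> * r ^ (2 * (j - 1) + 1)
       \<le> (\<gamma> * (M * T) * Y powr (- s - 1)) * Y powr ((2 * real j - 1) / (2 * real j))"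
      by (rule mult_mono[OF jb]) (use r \<gamma> MT in auto)
    also have "\<dots> = \<gamma> * (M * T) * Y powr (- s - 1 / (2 * real j))"
    proof -
      have "(- s - 1) + (2 * real j - 1) / (2 * real j) = - s - 1 / (2 * real j)"
        using j_pos by (simp add: field_simps)
      then show ?thesis by (simp only: mult.assoc powr_add[symmetric])
    qed
    finally have "(2 * real j * \<bar>b\<bar> * r ^ (2 * (j - 1) + 1)) powr q \<le> (\<gamma> * (M * T) * Y powr (- s - 1 / (2 * real j))) powr q"
      using q r by (intro powr_mono2) auto
    also have "\<dots> = H * Y powr ((- s - 1 / (2 * real j)) * q)"
      unfolding H_def using \<gamma> MT by (simp add: powr_mult powr_powr)
    \<comment> \<open>This is the critical relation (\<gamma> + 1) * q = \<gamma>, divided by 2j: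
      absorption decays exactly like the barrier.\<close>
    also have "(- s - 1 / (2 * real j)) * q = - s"
      unfolding s_def \<gamma>_def using q j_pos by (simp add: field_simps)
    finally show ?thesis .
  qed
  have "(2 * real j * \<bar>b\<bar>) powr (p - 1) * r powr \<mu> \<le> G * Y powr ((- s - 1) * (p - 1)) * Y powr (\<mu> / (2 * real j))"
    using e1 e2 by (intro mult_mono) (auto simp: G_def)
  \<comment> \<open>The surplus decay Y^(-\<delta>) of diffusion is at most A^(-\<delta>), which is
    small for large \<open>A\<close>.\<close>
  also have "\<dots> = G * Y powr (- s) * Y powr (- \<delta>)"
  proof -
    have "(- s - 1) * (p - 1) + \<mu> / (2 * real j) = - s + - \<delta>"
      unfolding s_def \<delta>_def \<mu>_def using j_pos by (simp add: field_simps)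
    then show ?thesis by (simp add: powr_add[symmetric] mult.assoc)
  qed
  also have "\<dots> \<le> G * Y powr (- s) * A powr (- \<delta>)"
    using Yp A \<delta> by (intro mult_left_mono powr_mono2') (auto simp: G_def)
  finally have e4: "(2 * real j * \<bar>b\<bar>) powr (p - 1) * r powr \<mu> \<le> G * Y powr (- s) * A powr (- \<delta>)" .
  define D where "D = (2 * real j * \<bar>b\<bar>) powr (p - 1) * r powr \<mu>"
  have D0: "D \<ge> 0" unfolding D_def by simp
  \<comment> \<open>The barrier decreases in r^(2j) (b < 0) and is convex in it, so this part of the
    p-Laplacian has the sign favourable to a subsolution and is discarded.\<close>
  have Q: "2 * real j * (p - 1) * (X / b) * r ^ (2 * j) \<le> 0"
    using Xb p1 r j_pos by (intro mult_nonpos_nonneg mult_nonneg_nonpos) auto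
  have "D * (2 * real j * (p - 1) * (X / b) * r ^ (2 * j) + \<mu> + N) \<le> D * (\<mu> + N)"
    using D0 Q by (intro mult_left_mono) auto
  also have "\<dots> \<le> G * Y powr (- s) * A powr (- \<delta>) * (\<mu> + N)"
    using e4 \<mu>_pos N unfolding D_def by (intro mult_right_mono) auto
  also have "\<dots> = (G * (\<mu> + N) * A powr (- \<delta>)) * Y powr (- s)" by simp
  also have "\<dots> < (M / 2) * Y powr (- s)"
    using Ap Yp unfolding G_def by (intro mult_strict_right_mono) auto
  finally have "D * (2 * real j * (p - 1) * (X / b) * r ^ (2 * j) + \<mu> + N) < M / 2 * Y powr (- s)" .
  moreover have "(2 * real j * \<bar>b\<bar> * r ^ (2 * (j - 1) + 1)) powr q \<le> (M / 2) * Y powr (- s)"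
    using e3 mult_right_mono[OF Mq, of "Y powr (- s)"] unfolding H_def by simp
  moreover have "sgn b = - 1" using b by simp
  then have "sgn b * (2 * real j * \<bar>b\<bar>) powr (p - 1) * r powr \<mu> = - D" unfolding D_def by (simp only: mult_minus1 minus_mult_left mult.assoc)
  ultimately show ?thesis by (simp only: mult_minus_left)
qed

text \<open>The constants are fixed in the order T, M, then R and m, and finally A, each depending
  on the earlier ones. The barrier tends to 0 at infinity and u is nonnegative, so a negative value
  of the difference forces an attained minimum.\<close>

lemma positivity_of_slow_decay:
  fixes u0 :: "real^'n \<Rightarrow> real" and q :: real
  assumes q: "0 < q" "2 * q < p" and sol: "cauchy_sol p q u0 u"
    and tail: "filterlim (\<lambda>x. norm x powr (q / (1 - q)) * u0 x) at_top at_infinity"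
    and pos: "\<And>x. u0 x > 0" and t: "0 \<le> t"
  shows "u t x > 0"
proof -
  have q1: "q < 1" using q p2 by simp
  \<comment> \<open>Any horizon beyond \<open>t\<close> keeps the barrier positive at time
    \<open>t\<close>.\<close>
  define T where "T = t + 1"
  have T: "T > 0" "t < T" unfolding T_def using t by auto
  define \<gamma> where "\<gamma> = q / (1 - q)"
  define \<delta> where "\<delta> = (p + (p - 2) * \<gamma>) / (2 * real j)"
  define s where "s = \<gamma> / (2 * real j)"
  define N where "N = real CARD('n)"
  have \<gamma>: "\<gamma> > 0" unfolding \<gamma>_def using q q1 by simp
  have s: "s > 0" unfolding s_def using \<gamma> j_pos by simp
  \<comment> \<open>The left side is p - 2 * q.\<close>
  have "p * (1 - q) + (p - 2) * q > 0" using q by (simp add: algebra_simps)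
  then have "(p * (1 - q) + (p - 2) * q) / (1 - q) > 0" using q1 by (intro divide_pos_pos) auto
  also have "(p * (1 - q) + (p - 2) * q) / (1 - q) = p + (p - 2) * \<gamma>"
    unfolding \<gamma>_def using q1 by (simp add: field_simps)
  finally have \<delta>: "\<delta> > 0" unfolding \<delta>_def using j_pos by simp
  \<comment> \<open>\<open>M\<close> solves (\<gamma> M T)^q = M / 2, so absorption uses up at most
    half of the time derivative.\<close>
  define M where "M = (2 * (\<gamma> * T) powr q) powr (1 / (1 - q))"
  have M: "M > 0" unfolding M_def using \<gamma> T by simp
  have Mq: "(\<gamma> * (M * T)) powr q \<le> M / 2"
  proof -
    have "M powr (1 - q) = 2 * (\<gamma> * T) powr q" unfolding M_def using q1 \<gamma> T by (simp add: powr_powr)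
    then have "M powr q * (2 * (\<gamma> * T) powr q) = M powr q * M powr (1 - q)" by simp
    also have "\<dots> = M" using M by (simp flip: powr_add)
    finally show ?thesis using M \<gamma> T by (simp add: powr_mult field_simps)
  qed
  have cont: "continuous_on ({0..} \<times> UNIV) (\<lambda>(t,x). u t x)" and nn: "\<And>t x. t \<ge> 0 \<Longrightarrow> u t x \<ge> 0"
    and u0: "\<And>x. u 0 x = u0 x" and sup: "visc_supersol p q {0<..} u"
    using sol unfolding cauchy_sol_def visc_sol_def by auto
  have cu0: "continuous_on UNIV u0"
  proof -
    have "continuous_on UNIV (\<lambda>x. (\<lambda>(t,x). u t x) (0, x))"
      by (rule continuous_on_compose2[OF cont]) (auto intro!: continuous_intros)
    then show ?thesis using u0 by simp
  qed
  \<comment> \<open>With \<open>M\<close> fixed, divergence of the weighted datum lifts u0 above M T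
    |x|^(-\<gamma>) off a ball; on that ball, continuity and positivity give the lower bound
    \<open>m\<close> below.\<close>
  obtain R where R: "R > 0" "\<And>x. norm x \<ge> R \<Longrightarrow> norm x powr \<gamma> * u0 x \<ge> M * T"
  proof -
    have "\<forall>\<^sub>F x in at_infinity. M * T \<le> norm x powr \<gamma> * u0 x"
      using tail unfolding filterlim_at_top \<gamma>_def by blast
    then obtain B where "\<And>x. norm x \<ge> B \<Longrightarrow> M * T \<le> norm x powr \<gamma> * u0 x"
      unfolding eventually_at_infinity by blast
    then show ?thesis using that[of "max B 1"] by auto
  qed
  obtain m where m: "m > 0" "\<And>x. norm x \<le> R \<Longrightarrow> m \<le> u0 x"
  proof -
    have "cball (0::real^'n) R \<noteq> {}" using R by simp
    from continuous_attains_inf[OF compact_cball this continuous_on_subset[OF cu0]] obtain z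
      where "\<forall>x\<in>cball 0 R. u0 z \<le> u0 x" by auto
    then show ?thesis using that[of "u0 z"] pos by auto
  qed
  \<comment> \<open>A large \<open>A\<close> makes diffusion cost less than the remaining half of
    the time derivative, and also lowers the barrier below \<open>m\<close>.\<close>
  obtain A where A: "A > 0" "(\<gamma> * (M * T)) powr (p - 1) * (\<mu> + N) * A powr (- \<delta>) < M / 2"
     "M * T * A powr (- s) < m"
  proof -
    have "((\<lambda>A. (\<gamma> * (M * T)) powr (p - 1) * (\<mu> + N) * A powr (- \<delta>)) \<longlongrightarrow> (\<gamma> * (M * T)) powr (p - 1) * (\<mu> + N) * 0) at_top"
      by (intro tendsto_mult_left tendsto_neg_powr) (use \<delta> in \<open>auto intro: filterlim_ident\<close>)
    then have 1: "\<forall>\<^sub>F A in at_top. (\<gamma> * (M * T)) powr (p - 1) * (\<mu> + N) * A powr (- \<delta>) < M / 2"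
      by (rule order_tendstoD) (use M in auto)
    have "((\<lambda>A. M * T * A powr (- s)) \<longlongrightarrow> M * T * 0) at_top"
      by (intro tendsto_mult_left tendsto_neg_powr) (use s in \<open>auto intro: filterlim_ident\<close>)
    then have 2: "\<forall>\<^sub>F A in at_top. M * T * A powr (- s) < m"
      by (rule order_tendstoD) (use m in auto)
    have "\<forall>\<^sub>F A in at_top. A > 0 \<and> (\<gamma> * (M * T)) powr (p - 1) * (\<mu> + N) * A powr (- \<delta>) < M / 2 \<and>
     M * T * A powr (- s) < m"
      using 1 2 eventually_gt_at_top[of "0::real"] by eventually_elim auto
    from eventually_happens'[OF trivial_limit_at_top_linorder this] show ?thesis using that by blast
  qed
  define \<phi> where "\<phi> = (\<lambda>t y. M * (T - t) * (A + y) powr (- s))"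
  have rp: "rpow j (0::real^'n) x \<ge> 0" for x :: "real^'n" unfolding rpow_eq_norm by simp
  define w where "w = (\<lambda>t x. u t x - \<phi> t (rpow j 0 x))"
  have init: "w 0 x \<ge> 0" for x
  proof (cases "norm x \<le> R")
    case True
    have "(A + rpow j 0 x) powr (- s) \<le> A powr (- s)"
      using A s rp[of x] by (intro powr_mono2') auto
    then have "M * T * (A + rpow j 0 x) powr (- s) \<le> M * T * A powr (- s)"
      using M T by (intro mult_left_mono) auto
    then show ?thesis using m(2)[OF True] A(3) unfolding w_def \<phi>_def u0 by simp
  next
    case False
    then have x: "norm x > 0" using R by linarith
    have "(A + rpow j 0 x) powr (- s) \<le> rpow j 0 x powr (- s)"
      using A s x unfolding rpow_eq_norm by (intro powr_mono2') auto
    also have "rpow j 0 x powr (- s) = norm x powr (- \<gamma>)"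
      unfolding rpow_eq_norm s_def using x j_pos by (simp add: powr_powr flip: powr_realpow)
    finally have "M * T * (A + rpow j 0 x) powr (- s) \<le> M * T * norm x powr (- \<gamma>)"
      using M T by (intro mult_left_mono) auto
    also have "\<dots> \<le> norm x powr \<gamma> * u0 x * norm x powr (- \<gamma>)"
      using R(2)[of x] False by (intro mult_right_mono) auto
    also have "\<dots> = u0 x" using x by (simp add: powr_minus field_simps)
    finally show ?thesis unfolding w_def \<phi>_def u0 by simp
  qed
  have "w t x \<ge> 0"
  proof (rule ccontr)
    assume neg: "\<not> w t x \<ge> 0"
    define v where "v = - w t x"
    have v: "v > 0" unfolding v_def using neg by simp
    have "\<forall>\<^sub>F y in at_top. M * T * (A + y ^ (2 * j)) powr (- s) < v"
    proof -
      have "filterlim (\<lambda>y::real. A + y ^ (2 * j)) at_top at_top"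
        by (rule filterlim_tendsto_add_at_top[OF tendsto_const])
          (use j_pos in \<open>auto intro!: filterlim_pow_at_top filterlim_ident\<close>)
      then have "((\<lambda>y. M * T * (A + y ^ (2 * j)) powr (- s)) \<longlongrightarrow> M * T * 0) at_top"
        by (intro tendsto_mult_left tendsto_neg_powr) (use s in auto)
      then show ?thesis by (rule order_tendstoD) (use v in auto)
    qed
    then obtain \<rho> where \<rho>: "\<And>y. y \<ge> \<rho> \<Longrightarrow> M * T * (A + y ^ (2 * j)) powr (- s) < v"
      unfolding eventually_at_top_linorder by blast
    have cw: "continuous_on ({0..T} \<times> UNIV) (\<lambda>(t,x). w t x)"
    proof -
      have "continuous_on ({0..T} \<times> UNIV) (\<lambda>z. (case z of (t,x) \<Rightarrow> u t x)
          - M * (T - fst z) * (A + rpow j 0 (snd z)) powr (- s))"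
        unfolding rpow_eq_norm using A
        by (intro continuous_intros continuous_on_subset[OF cont]) (auto simp: add_nonneg_eq_0_iff)
      then show ?thesis unfolding w_def \<phi>_def by (simp add: case_prod_unfold)
    qed
    obtain t0 x0 where t0: "0 \<le> t0" "t0 \<le> T" and min: "\<And>s y. 0 \<le> s \<Longrightarrow> s \<le> T \<Longrightarrow> w t0 x0 \<le> w s y"
    proof (rule continuous_attains_inf_time_space[OF cw, of \<rho> t x])
      fix r and y :: "real^'n" assume r: "0 \<le> r" "r \<le> T" and y: "\<rho> < norm y"
      have "\<phi> r (rpow j 0 y) \<le> M * T * (A + norm y ^ (2 * j)) powr (- s)"
        unfolding \<phi>_def rpow_eq_norm diff_zero using M r by (intro mult_right_mono mult_left_mono) auto
      also have "\<dots> < v" using \<rho> y by simp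
      finally show "w t x \<le> w r y" using nn[OF r(1), of y] unfolding v_def w_def by simp
    qed (use t T in auto)
    have w0: "w t0 x0 < 0" using min[of t x] neg t T by simp
    \<comment> \<open>The negative minimum lies strictly inside: \<open>init\<close> excludes time
      0, and at time \<open>T\<close> the barrier vanishes while u is nonnegative.\<close>
    have t00: "t0 > 0" using w0 init[of x0] t0 by (cases "t0 = 0") auto
    have t0T: "t0 < T" using w0 nn[of t0 x0] t0 by (cases "t0 = T") (auto simp: w_def \<phi>_def)
    define Y where "Y = A + norm x0 ^ (2 * j)"
    define F where "F = M * (T - t0)"
    have F: "F > 0" "F \<le> M * T" unfolding F_def using M t00 t0T by auto
    have Y: "Y > 0" unfolding Y_def using A by (simp add: add_pos_nonneg)
    have Yr: "A + rpow j 0 x0 = Y" unfolding Y_def rpow_eq_norm by simp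
    define b where "b = - s * F * Y powr (- s - 1)"
    define X where "X = s * (s + 1) * F * Y powr (- s - 2)"
    have b: "b \<noteq> 0" unfolding b_def using s F Y by simp
    have jet: "has_jet \<phi> t0 (rpow j 0 x0) (- M * Y powr (- s)) b X"
      using has_jet_decaying[of A "rpow j 0 x0" M T s t0] Y unfolding \<phi>_def F_def b_def X_def Yr by simp
    have "loc_min_at {0<..} (\<lambda>t x. u t x - \<phi> t (rpow j 0 x)) t0 x0"
      unfolding loc_min_at_def
      by (rule exI[of _ "T - t0"]) (use t0T min in \<open>auto simp: w_def\<close>)
    note * = supersol_radial[OF sup t00 jet b this, unfolded rpow_eq_norm diff_zero N_def[symmetric]]
    show False
    proof (cases "x0 = 0")
      case True
      then have "M * Y powr (- s) \<le> 0" using * by simp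
      then show False using M Y by (simp add: mult_le_0_iff)
    next
      case False
      have "- M * Y powr (- s) < sgn b * (2 * real j * \<bar>b\<bar>) powr (p - 1) * norm x0 powr \<mu>
        * (2 * real j * (p - 1) * (X / b) * norm x0 ^ (2 * j) + \<mu> + N)
        - (2 * real j * \<bar>b\<bar> * norm x0 ^ (2 * (j - 1) + 1)) powr q"
        unfolding b_def X_def s_def \<gamma>_def
        by (rule decaying_strict_subsolution[where T = T and A = A])
          (use q q1 M F A \<delta> Mq False Y_def in \<open>auto simp: \<gamma>_def \<delta>_def N_def\<close>)
      with * False show False by simp
    qed
  qed
  moreover have "\<phi> t (rpow j 0 x) > 0"
    unfolding \<phi>_def using M T A rp[of x] by simp
  ultimately show ?thesis unfolding w_def by simp
qed

end

section \<open>Decay at infinity\<close>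

lemma has_jet_blow_up:
  fixes m \<epsilon> \<eta> L T \<sigma> t0 y0 :: real
  assumes L: "0 < L" and y0: "y0 < L" and t0: "t0 < T"
  defines "D \<equiv> 1 - y0 / L"
  shows "has_jet (\<lambda>t y. m + \<epsilon> * (1 + t) * (1 - y / L) powr (- \<sigma>) + \<eta> / (T - t)) t0 y0
    (\<epsilon> * D powr (- \<sigma>) + \<eta> / (T - t0)\<^sup>2) (\<epsilon> * (1 + t0) * \<sigma> / L * D powr (- \<sigma> - 1))
    (\<epsilon> * (1 + t0) * \<sigma> * (\<sigma> + 1) / L\<^sup>2 * D powr (- \<sigma> - 2))"
  unfolding has_jet_def
proof (intro exI[of _ "\<lambda>t y. \<epsilon> * (1 - y / L) powr (- \<sigma>) + \<eta> / (T - t)\<^sup>2"]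
    exI[of _ "\<lambda>y. \<epsilon> * (1 + t0) * \<sigma> / L * (1 - y / L) powr (- \<sigma> - 1)"]
    exI[of _ "min (L - y0) (T - t0)"] conjI allI impI)
  have D: "D > 0" unfolding D_def using L y0 by simp
  then show "(\<lambda>(t, y). \<epsilon> * (1 - y / L) powr (- \<sigma>) + \<eta> / (T - t)\<^sup>2) differentiable at (t0, y0)"
    unfolding differentiable_def case_prod_unfold
    by (intro exI) (use L t0 in \<open>auto intro!: derivative_eq_intros simp: D_def\<close>)
  show "((\<lambda>t. m + \<epsilon> * (1 + t) * (1 - y / L) powr - \<sigma> + \<eta> / (T - t)) has_real_derivative
      \<epsilon> * (1 - y / L) powr (- \<sigma>) + \<eta> / (T - t)\<^sup>2) (at t)"
    if "\<bar>t - t0\<bar> < min (L - y0) (T - t0)" for t y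
    using that by (auto intro!: derivative_eq_intros simp: power2_eq_square)
  have dD: "((\<lambda>y. (1 - y / L) powr r) has_real_derivative - (r / L) * (1 - y / L) powr (r - 1)) (at y)"
    if "y < L" for r y
  proof -
    have "1 - y / L > 0" using that L by simp
    then have "((\<lambda>y. (1 - y / L) powr r) has_real_derivative r * (1 - y / L) powr (r - real 1) * (- 1 / L)) (at y)"
      by (intro DERIV_fun_powr) (use L in \<open>auto intro!: derivative_eq_intros\<close>)
    then show ?thesis by simp
  qed
  show "((\<lambda>y. m + \<epsilon> * (1 + t0) * (1 - y / L) powr - \<sigma> + \<eta> / (T - t0)) has_real_derivative
      \<epsilon> * (1 + t0) * \<sigma> / L * (1 - y / L) powr (- \<sigma> - 1)) (at y)"
    if "\<bar>y - y0\<bar> < min (L - y0) (T - t0)" for y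
  proof -
    have y: "y < L" using that by linarith
    show ?thesis by (rule derivative_eq_intros dD[OF y] refl)+ simp
  qed
  show "((\<lambda>y. \<epsilon> * (1 + t0) * \<sigma> / L * (1 - y / L) powr (- \<sigma> - 1)) has_real_derivative
      \<epsilon> * (1 + t0) * \<sigma> * (\<sigma> + 1) / L\<^sup>2 * D powr (- \<sigma> - 2)) (at y0)"
    unfolding D_def
    by (rule derivative_eq_intros dD[OF y0] refl)+ (use L in \<open>simp add: power2_eq_square field_simps\<close>)
qed (use L y0 t0 in \<open>auto simp: D_def\<close>)

context radial_profile
begin

text \<open>Scaling gives the factor \<open>L powr (- p / (2 * j))\<close>, while \<open>\<sigma> = p / (2 - p)\<close> is the exponent for
  which the p-Laplacian of the blow-up profile \<open>D powr (- \<sigma>)\<close> is bounded by the profile itself.\<close>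

lemma blow_up_strict_supersolution:
  fixes \<epsilon> \<theta> \<Theta> L N r y D :: real
  defines "\<sigma> \<equiv> p / (2 - p)"
  assumes \<theta>: "0 < \<theta>" "\<theta> \<le> \<Theta>" and L: "0 < L" and N: "0 \<le> N"
    and large: "(2 * real j * \<sigma> * \<Theta>) powr (p - 1) * (2 * real j * (p - 1) * (\<sigma> + 1) + \<mu> + N) * L powr (- p / (2 * real j)) < \<epsilon>"
    and r: "0 < r" and y: "y = r ^ (2 * j)" "y < L" and D: "D = 1 - y / L"
  defines "b \<equiv> \<theta> * \<sigma> / L * D powr (- \<sigma> - 1)"
  defines "X \<equiv> \<theta> * \<sigma> * (\<sigma> + 1) / L\<^sup>2 * D powr (- \<sigma> - 2)"
  shows "sgn b * (2 * real j * \<bar>b\<bar>) powr (p - 1) * r powr \<mu>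
      * (2 * real j * (p - 1) * (X / b) * y + \<mu> + N) < \<epsilon> * D powr (- \<sigma>)"
proof -
  have \<sigma>: "\<sigma> > 0" unfolding \<sigma>_def using p1 p2 by simp
  have y0: "y > 0" unfolding y using r by simp
  have D01: "0 < D" "D \<le> 1" unfolding D using y y0 L by auto
  have b: "b > 0" unfolding b_def using \<theta> \<sigma> L D01 by simp
  have Xb: "X / b = (\<sigma> + 1) / (L * D)"
  proof -
    have "D powr (- \<sigma> - 1) = D powr (- \<sigma> - 2) * D"
    proof -
      have "- \<sigma> - 1 = (- \<sigma> - 2) + 1" by simp
      then have "D powr (- \<sigma> - 1) = D powr (- \<sigma> - 2) * D powr 1" by (simp only: powr_add)
      then show ?thesis using D01 by simp
    qed
    then show ?thesis unfolding X_def b_def using \<theta> \<sigma> L D01 by (simp add: field_simps power2_eq_square)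
  qed
  define C where "C = 2 * real j * (p - 1) * (\<sigma> + 1) + \<mu> + N"
  have C: "C > 0" unfolding C_def using \<mu>_pos N p1 \<sigma> j_pos by (intro add_pos_nonneg add_nonneg_pos) auto
  \<comment> \<open>Both parts are compared with 1 / D: y < L bounds the term coming from the second
    derivative, and D \<le> 1 the constants.\<close>
  have "2 * real j * (p - 1) * (X / b) * y + \<mu> + N \<le> C / D"
  proof -
    have "2 * real j * (p - 1) * (X / b) * y = (2 * real j * (p - 1) * (\<sigma> + 1)) * (y / L) / D"
      unfolding Xb by simp
    also have "\<dots> \<le> (2 * real j * (p - 1) * (\<sigma> + 1)) * 1 / D"
      using y L p1 \<sigma> D01 by (intro divide_right_mono mult_left_mono) auto
    finally have 1: "2 * real j * (p - 1) * (X / b) * y \<le> (2 * real j * (p - 1) * (\<sigma> + 1)) / D" by simp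
    have "\<mu> + N \<le> (\<mu> + N) / D" using D01 \<mu>_pos N by (simp add: le_divide_eq mult_left_le)
    with 1 show ?thesis unfolding C_def by (simp add: add_divide_distrib)
  qed
  moreover have "r powr \<mu> \<le> L powr (\<mu> / (2 * real j))"
    using powr_le_base[OF j_pos, of r L \<mu>] r y \<mu>_pos L by simp
  moreover have "(2 * real j * b) powr (p - 1) \<le> (2 * real j * \<sigma> * \<Theta>) powr (p - 1) * L powr (- (p - 1)) * D powr ((- \<sigma> - 1) * (p - 1))"
  proof -
    have "2 * real j * b = (2 * real j * \<sigma> * \<theta>) * L powr (- 1) * D powr (- \<sigma> - 1)"
      unfolding b_def using L by (simp add: powr_minus field_simps)
    also have "\<dots> \<le> (2 * real j * \<sigma> * \<Theta>) * L powr (- 1) * D powr (- \<sigma> - 1)"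
      using \<theta> \<sigma> by (intro mult_right_mono mult_left_mono) auto
    finally have "(2 * real j * b) powr (p - 1) \<le> ((2 * real j * \<sigma> * \<Theta>) * L powr (- 1) * D powr (- \<sigma> - 1)) powr (p - 1)"
      using b p1 by (intro powr_mono2) auto
    also have "\<dots> = (2 * real j * \<sigma> * \<Theta>) powr (p - 1) * L powr (- (p - 1)) * D powr ((- \<sigma> - 1) * (p - 1))"
      by (simp only: powr_mult powr_powr mult_minus1)
    finally show ?thesis .
  qed
  ultimately have "(2 * real j * b) powr (p - 1) * r powr \<mu> * (2 * real j * (p - 1) * (X / b) * y + \<mu> + N)
     \<le> ((2 * real j * \<sigma> * \<Theta>) powr (p - 1) * L powr (- (p - 1)) * D powr ((- \<sigma> - 1) * (p - 1)))
        * L powr (\<mu> / (2 * real j)) * (C / D)"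
    using C D01 b y0 p1 Xb \<sigma> L \<mu>_pos N
    by (intro mult_mono) (auto intro!: add_nonneg_nonneg mult_nonneg_nonneg)
  also have "\<dots> = ((2 * real j * \<sigma> * \<Theta>) powr (p - 1) * C * (L powr (- (p - 1)) * L powr (\<mu> / (2 * real j))))
        * (D powr ((- \<sigma> - 1) * (p - 1)) / D)" by simp
  also have "L powr (- (p - 1)) * L powr (\<mu> / (2 * real j)) = L powr (- p / (2 * real j))"
  proof -
    have "- (p - 1) + \<mu> / (2 * real j) = - p / (2 * real j)"
      unfolding \<mu>_def using j_pos by (simp add: field_simps)
    then show ?thesis by (simp flip: powr_add)
  qed
  also have "D powr ((- \<sigma> - 1) * (p - 1)) / D = D powr (- \<sigma>)"
  proof -
    have "(- \<sigma> - 1) * (p - 1) - 1 = - \<sigma>"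
      unfolding \<sigma>_def using p2 by (simp add: field_simps)
    then show ?thesis using D01 powr_diff[of D "(- \<sigma> - 1) * (p - 1)" 1] by simp
  qed
  also have "((2 * real j * \<sigma> * \<Theta>) powr (p - 1) * C * L powr (- p / (2 * real j))) * D powr (- \<sigma>) < \<epsilon> * D powr (- \<sigma>)"
    using large D01 unfolding C_def by (intro mult_strict_right_mono) auto
  finally show ?thesis using b by simp
qed

text \<open>The barrier is infinite on the sphere of radius R about x1, so no information on u along
  the lateral boundary enters. The radius is chosen before the centre and the level
  \<open>m\<close>, and this uniformity is what allows the centre to go to infinity.\<close>

lemma local_upper_bound:
  fixes u :: "real \<Rightarrow> real^'n \<Rightarrow> real"
  assumes sub: "visc_subsol p q {0<..} u" and cont: "continuous_on ({0..} \<times> UNIV) (\<lambda>(t,x). u t x)"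
    and T: "0 < T" and \<epsilon>: "0 < \<epsilon>"
  shows "\<exists>R>0. \<forall>x1 m t. 0 \<le> m \<longrightarrow> (\<forall>x\<in>ball x1 R. u 0 x \<le> m) \<longrightarrow> 0 \<le> t \<longrightarrow> t < T \<longrightarrow> u t x1 \<le> m + \<epsilon> * (1 + t)"
proof -
  define \<sigma> where "\<sigma> = p / (2 - p)"
  have \<sigma>: "\<sigma> > 0" unfolding \<sigma>_def using p1 p2 by simp
  define N where "N = real CARD('n)"
  define \<Theta> where "\<Theta> = \<epsilon> * (1 + T)"
  obtain L where L: "L > 0" and large: "(2 * real j * \<sigma> * \<Theta>) powr (p - 1) * (2 * real j * (p - 1) * (\<sigma> + 1) + \<mu> + N) * L powr (- p / (2 * real j)) < \<epsilon>"
  proof -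
    let ?c = "(2 * real j * \<sigma> * \<Theta>) powr (p - 1) * (2 * real j * (p - 1) * (\<sigma> + 1) + \<mu> + N)"
    have "((\<lambda>L. ?c * L powr (- p / (2 * real j))) \<longlongrightarrow> ?c * 0) at_top"
      by (intro tendsto_mult_left tendsto_neg_powr) (use p1 j_pos in \<open>auto intro: filterlim_ident simp: divide_less_0_iff\<close>)
    then have "\<forall>\<^sub>F L in at_top. ?c * L powr (- p / (2 * real j)) < \<epsilon>"
      by (rule order_tendstoD) (use \<epsilon> in auto)
    then have "\<forall>\<^sub>F L in at_top. L > 0 \<and> ?c * L powr (- p / (2 * real j)) < \<epsilon>"
      using eventually_gt_at_top[of "0::real"] by eventually_elim auto
    from eventually_happens'[OF trivial_limit_at_top_linorder this] show ?thesis using that by blast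
  qed
  define R where "R = root (2 * j) L"
  have R: "R > 0" "R ^ (2 * j) = L" unfolding R_def using L j_pos by auto
  have rlt: "rpow j x1 x < L \<longleftrightarrow> norm (x - x1) < R" for x x1 :: "real^'n"
    unfolding rpow_eq_norm R(2)[symmetric] using R(1) j_pos
    by (auto intro: power_strict_mono power_less_imp_less_base)
  have rp: "rpow j x1 x \<ge> 0" for x x1 :: "real^'n" unfolding rpow_eq_norm by simp
  have "u t x1 \<le> m + \<epsilon> * (1 + t)" if m: "0 \<le> m" and init: "\<And>x. x \<in> ball x1 R \<Longrightarrow> u 0 x \<le> m"
    and t: "0 \<le> t" "t < T" for x1 m t
  proof (rule ccontr)
    assume neg: "\<not> u t x1 \<le> m + \<epsilon> * (1 + t)"
    \<comment> \<open>The penalty \<eta> / (T - t) takes only half of the excess at (t, x1), so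
      \<open>w\<close> stays positive there. It keeps the maximum away from time \<open>T\<close>
      and adds strictness to the time derivative.\<close>
    define \<eta> where "\<eta> = (u t x1 - (m + \<epsilon> * (1 + t))) / 2 * (T - t)"
    have \<eta>: "\<eta> > 0" unfolding \<eta>_def using neg t by simp
    define \<phi> where "\<phi> = (\<lambda>t y. m + \<epsilon> * (1 + t) * (1 - y / L) powr (- \<sigma>) + \<eta> / (T - t))"
    define w where "w = (\<lambda>t x. u t x - \<phi> t (rpow j x1 x))"
    have wt: "w t x1 > 0"
    proof -
      have "\<eta> / (T - t) = (u t x1 - (m + \<epsilon> * (1 + t))) / 2"
        unfolding \<eta>_def using t by (intro nonzero_mult_div_cancel_right) simp
      moreover have "rpow j x1 x1 = 0" unfolding rpow_def using j_pos by simp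
      ultimately show ?thesis unfolding w_def \<phi>_def using neg by (simp add: field_simps)
    qed
    obtain K where K: "K > 0" "\<And>t x. 0 \<le> t \<Longrightarrow> t \<le> T \<Longrightarrow> norm (x - x1) \<le> R \<Longrightarrow> u t x < K"
    proof -
      have "compact ((\<lambda>(t,x). u t x) ` ({0..T} \<times> cball x1 R))"
        by (intro compact_continuous_image compact_Times compact_cball compact_Icc continuous_on_subset[OF cont]) auto
      then obtain B where B: "\<And>z. z \<in> {0..T} \<times> cball x1 R \<Longrightarrow> norm ((\<lambda>(t,x). u t x) z) \<le> B"
        using compact_imp_bounded bounded_iff by (metis (no_types, lifting) imageI)
      have "u t x < max 1 (B + 1)" if "0 \<le> t" "t \<le> T" "norm (x - x1) \<le> R" for t x
        using B[of "(t, x)"] that by (auto simp: dist_norm norm_minus_commute)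
      then show ?thesis using that[of "max 1 (B + 1)"] by auto
    qed
    \<comment> \<open>Where 1 - rpow / L < d the blow-up term alone exceeds the bound
      \<open>K\<close> on u, and within \<tau> of time \<open>T\<close> the penalty does. The
      positive maximum is therefore sought on the compact set \<open>S\<close>.\<close>
    define d where "d = (K / \<epsilon>) powr (- 1 / \<sigma>)"
    have d: "d > 0" unfolding d_def using K \<epsilon> by simp
    define \<tau> where "\<tau> = \<eta> / K"
    have \<tau>: "\<tau> > 0" unfolding \<tau>_def using \<eta> K by simp
    define Sx where "Sx = cball x1 R \<inter> {x. rpow j x1 x \<le> (1 - d) * L}"
    define S where "S = {0..T - \<tau>} \<times> Sx"
    have far: "w s x < 0" if s: "0 \<le> s" "s < T" and x: "rpow j x1 x < L" and nS: "(s, x) \<notin> S" for s x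
    proof -
      have x': "norm (x - x1) < R" using x rlt by simp
      define D where "D = 1 - rpow j x1 x / L"
      have D: "D > 0" unfolding D_def using x L by simp
      have uK: "u s x < K" using K(2)[of s x] s x' by simp
      have pos1: "\<epsilon> * (1 + s) * D powr (- \<sigma>) > 0" using \<epsilon> s D by simp
      have pos2: "\<eta> / (T - s) > 0" using \<eta> s by simp
      from nS have "s > T - \<tau> \<or> rpow j x1 x > (1 - d) * L"
        unfolding S_def Sx_def using s x' by (auto simp: dist_norm norm_minus_commute)
      then show ?thesis
      proof
        assume "s > T - \<tau>"
        then have "\<eta> / (T - s) > K" unfolding \<tau>_def using K s \<eta> by (simp add: field_simps)
        then show ?thesis unfolding w_def \<phi>_def D_def[symmetric] using uK m pos1 by linarith
      next
        assume "rpow j x1 x > (1 - d) * L"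
        then have "D < d" unfolding D_def using L by (simp add: field_simps)
        then have "d powr (- \<sigma>) \<le> D powr (- \<sigma>)" using D \<sigma> by (intro powr_mono2') auto
        moreover have "d powr (- \<sigma>) = K / \<epsilon>" unfolding d_def using \<sigma> K \<epsilon> by (simp add: powr_powr)
        ultimately have "K \<le> \<epsilon> * D powr (- \<sigma>)" using \<epsilon> by (simp add: field_simps)
        also have "\<dots> \<le> \<epsilon> * (1 + s) * D powr (- \<sigma>)" using \<epsilon> s by (intro mult_right_mono) auto
        finally show ?thesis unfolding w_def \<phi>_def D_def[symmetric] using uK m pos2 by linarith
      qed
    qed
    have r1: "rpow j x1 x1 = 0" unfolding rpow_def using j_pos by simp
    have tS: "(t, x1) \<in> S" using far[of t x1] wt t L r1 by auto
    have SD: "0 \<le> s \<and> s < T \<and> rpow j x1 x < L" if "(s, x) \<in> S" for s x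
    proof -
      have "(1 - d) * L < L" using d L by (simp add: algebra_simps)
      then show ?thesis using that \<tau> unfolding S_def Sx_def by auto
    qed
    have compS: "compact S"
      unfolding S_def Sx_def rpow_eq_norm
      by (intro compact_Times compact_Icc compact_Int_closed compact_cball closed_Collect_le continuous_intros)
    have "continuous_on S (\<lambda>z. (case z of (t,x) \<Rightarrow> u t x)
        - (m + \<epsilon> * (1 + fst z) * (1 - rpow j x1 (snd z) / L) powr (- \<sigma>) + \<eta> / (T - fst z)))"
    proof -
      have "T - fst z \<noteq> 0" "1 - rpow j x1 (snd z) / L \<noteq> 0" if "z \<in> S" for z
        using SD[of "fst z" "snd z"] that L by auto
      moreover have "S \<subseteq> {0..} \<times> UNIV" unfolding S_def by auto
      moreover have "continuous_on S (\<lambda>z. rpow j x1 (snd z))"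
        unfolding rpow_eq_norm by (intro continuous_intros)
      ultimately show ?thesis using L
        by (intro continuous_intros continuous_on_subset[OF cont]) auto
    qed
    then have "continuous_on S (\<lambda>z. w (fst z) (snd z))" unfolding w_def \<phi>_def by (simp add: case_prod_unfold)
    from continuous_attains_sup[OF compS _ this] tS obtain t0 x0 where S0: "(t0, x0) \<in> S"
      and maxS: "\<And>s x. (s, x) \<in> S \<Longrightarrow> w s x \<le> w t0 x0" by fastforce
    have w0: "w t0 x0 > 0" using maxS[OF tS] wt by simp
    have max: "w s x \<le> w t0 x0" if "0 \<le> s" "s < T" "rpow j x1 x < L" for s x
      using maxS[of s x] far[OF that] w0 by fastforce
    define y where "y = rpow j x1 x0"
    have y: "0 \<le> y" "y < L" "norm (x0 - x1) < R" unfolding y_def using rp SD[OF S0] rlt by auto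
    have t0: "0 \<le> t0" "t0 < T" using SD[OF S0] by auto
    define D where "D = 1 - y / L"
    have D: "D > 0" unfolding D_def using y L by simp
    have t00: "t0 > 0"
    proof (rule ccontr)
      assume "\<not> t0 > 0"
      then have "t0 = 0" using t0 by simp
      moreover have "u 0 x0 \<le> m" using init[of x0] y by (simp add: dist_norm norm_minus_commute)
      moreover have "\<epsilon> * D powr (- \<sigma>) > 0" "\<eta> / T > 0" using \<epsilon> D \<eta> T by auto
      ultimately show False using w0 unfolding w_def \<phi>_def y_def[symmetric] D_def by simp
    qed
    define \<theta> where "\<theta> = \<epsilon> * (1 + t0)"
    have \<theta>: "0 < \<theta>" "\<theta> \<le> \<Theta>" unfolding \<theta>_def \<Theta>_def using \<epsilon> t0 by auto
    define a where "a = \<epsilon> * D powr (- \<sigma>) + \<eta> / (T - t0)\<^sup>2"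
    define b where "b = \<theta> * \<sigma> / L * D powr (- \<sigma> - 1)"
    define X where "X = \<theta> * \<sigma> * (\<sigma> + 1) / L\<^sup>2 * D powr (- \<sigma> - 2)"
    have a: "a > \<epsilon> * D powr (- \<sigma>)" unfolding a_def using \<eta> t0 by simp
    have b: "b \<noteq> 0" unfolding b_def using \<theta> \<sigma> L D by simp
    have jet: "has_jet \<phi> t0 (rpow j x1 x0) a b X"
      using has_jet_blow_up[OF L y(2) t0(2), of m \<epsilon> \<sigma> \<eta>]
      unfolding \<phi>_def a_def b_def X_def \<theta>_def D_def y_def .
    have "loc_max_at {0<..} (\<lambda>t x. u t x - \<phi> t (rpow j x1 x)) t0 x0"
      unfolding loc_max_at_def
    proof (intro exI[of _ "min (T - t0) (R - norm (x0 - x1))"] conjI allI impI)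
      fix s x assume sx: "s \<in> {0<..} \<and> \<bar>s - t0\<bar> < min (T - t0) (R - norm (x0 - x1)) \<and> norm (x - x0) < min (T - t0) (R - norm (x0 - x1))"
      have "norm (x - x1) \<le> norm (x - x0) + norm (x0 - x1)" using norm_triangle_ineq[of "x - x0" "x0 - x1"] by simp
      then have "rpow j x1 x < L" unfolding rlt using sx by simp
      then show "u s x - \<phi> s (rpow j x1 x) \<le> u t0 x0 - \<phi> t0 (rpow j x1 x0)"
        using max[of s x] sx unfolding w_def by auto
    qed (use t0 y in auto)
    note * = subsol_radial[OF sub t00 jet b this, folded y_def N_def]
    show False
    proof (cases "x0 = x1")
      case True
      have "\<epsilon> * D powr (- \<sigma>) \<ge> 0" using \<epsilon> by simp
      then show False using True * a by simp
    next
      case False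
      have "sgn b * (2 * real j * \<bar>b\<bar>) powr (p - 1) * norm (x0 - x1) powr \<mu>
        * (2 * real j * (p - 1) * (X / b) * y + \<mu> + N) < \<epsilon> * D powr (- \<sigma>)"
        unfolding b_def X_def \<sigma>_def
        by (rule blow_up_strict_supersolution[OF \<theta> L])
          (use large False y D_def in \<open>auto simp: \<sigma>_def N_def y_def rpow_eq_norm\<close>)
      \<comment> \<open>Absorption only helps an upper barrier and is dropped.\<close>
      moreover have "(2 * real j * \<bar>b\<bar> * norm (x0 - x1) ^ (2 * (j - 1) + 1)) powr q \<ge> 0" by simp
      ultimately show False using * False a by (simp only: if_False)
    qed
  qed
  then show ?thesis using R by (intro exI[of _ R]) auto
qed

text \<open>The local bound is centred at a far point whose ball of radius R sees only data below
  \<epsilon> / 2. The growth rate \<open>e\<close> limits the increase up to time T to another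
  \<epsilon> / 2.\<close>

lemma uniform_decay:
  fixes u :: "real \<Rightarrow> real^'n \<Rightarrow> real"
  assumes sub: "visc_subsol p q {0<..} u" and cont: "continuous_on ({0..} \<times> UNIV) (\<lambda>(t,x). u t x)"
    and tail: "(u 0 \<longlongrightarrow> 0) at_infinity" and T: "0 < T" and \<epsilon>: "0 < \<epsilon>"
  shows "\<exists>\<rho>. \<forall>t x. 0 \<le> t \<longrightarrow> t \<le> T \<longrightarrow> \<rho> \<le> norm x \<longrightarrow> u t x \<le> \<epsilon>"
proof -
  define e where "e = \<epsilon> / (2 * (1 + T))"
  have e: "e > 0" unfolding e_def using T \<epsilon> by simp
  obtain R where R: "R > 0" and bd: "\<And>x1 m t. 0 \<le> m \<Longrightarrow> (\<And>x. x \<in> ball x1 R \<Longrightarrow> u 0 x \<le> m) \<Longrightarrow>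
      0 \<le> t \<Longrightarrow> t < T + 1 \<Longrightarrow> u t x1 \<le> m + e * (1 + t)"
    using local_upper_bound[OF sub cont, of "T + 1" e] T e by auto
  have "\<forall>\<^sub>F x in at_infinity. u 0 x < \<epsilon> / 2"
    using tail by (rule order_tendstoD) (use \<epsilon> in simp)
  then obtain B where B: "\<And>x. norm x \<ge> B \<Longrightarrow> u 0 x < \<epsilon> / 2" unfolding eventually_at_infinity by blast
  have "u t x \<le> \<epsilon>" if t: "0 \<le> t" "t \<le> T" and x: "B + R \<le> norm x" for t x
  proof -
    have "u t x \<le> \<epsilon> / 2 + e * (1 + t)"
    proof (rule bd)
      fix y assume "y \<in> ball x R"
      then have "norm y \<ge> B" using x norm_triangle_sub[of x y] by (simp add: dist_norm)
      then show "u 0 y \<le> \<epsilon> / 2" using B by fastforce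
    qed (use t \<epsilon> in auto)
    also have "e * (1 + t) \<le> e * (1 + T)" using e t by simp
    also have "e * (1 + T) = \<epsilon> / 2" unfolding e_def using T by (simp add: field_simps)
    finally show ?thesis by simp
  qed
  then show ?thesis by blast
qed

end

section \<open>Extinction for fast decaying data\<close>

text \<open>Along the plane wave x \<bullet> v may be negative, so the base of the power is known to
  be positive only near the contact point; this supplies the neighbourhood in which the profile is
  smooth.\<close>

lemma front_domain:
  fixes T \<beta> s1 t0 y0 :: real
  assumes "t0 < T" "0 < y0 * (T - t0) powr \<beta> + s1"
  shows "\<exists>d>0. \<forall>t y. \<bar>t - t0\<bar> < d \<longrightarrow> \<bar>y - y0\<bar> < d \<longrightarrow> t < T \<and> 0 < y * (T - t) powr \<beta> + s1"
proof -
  have "isCont (\<lambda>z::real \<times> real. snd z * (T - fst z) powr \<beta> + s1) (t0, y0)"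
    using assms(1) by (intro continuous_intros) auto
  then have "((\<lambda>z. snd z * (T - fst z) powr \<beta> + s1) \<longlongrightarrow> y0 * (T - t0) powr \<beta> + s1) (at (t0, y0))"
    by (simp add: continuous_at)
  then have 1: "\<forall>\<^sub>F z in at (t0, y0). 0 < snd z * (T - fst z) powr \<beta> + s1"
    by (rule order_tendstoD) (use assms in auto)
  have "((\<lambda>z::real \<times> real. fst z) \<longlongrightarrow> fst (t0, y0)) (at (t0, y0))"
    by (intro tendsto_intros)
  then have "\<forall>\<^sub>F z in at (t0, y0). fst z < T"
    by (rule order_tendstoD) (use assms in auto)
  with 1 have "\<forall>\<^sub>F z in at (t0, y0). fst z < T \<and> 0 < snd z * (T - fst z) powr \<beta> + s1"
    by eventually_elim auto
  then have "\<forall>\<^sub>F z in nhds (t0, y0). fst z < T \<and> 0 < snd z * (T - fst z) powr \<beta> + s1"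
    unfolding eventually_nhds_conv_at using assms by simp
  then obtain d where d: "d > 0" "\<And>z. dist z (t0, y0) < d \<Longrightarrow> fst z < T \<and> 0 < snd z * (T - fst z) powr \<beta> + s1"
    unfolding eventually_nhds_metric by blast
  have "t < T \<and> 0 < y * (T - t) powr \<beta> + s1" if "\<bar>t - t0\<bar> < d / 2" "\<bar>y - y0\<bar> < d / 2" for t y
  proof -
    have "dist (t, y) (t0, y0) \<le> \<bar>t - t0\<bar> + \<bar>y - y0\<bar>"
      by (simp add: dist_Pair_Pair dist_real_def sqrt_sum_squares_le_sum_abs)
    then show ?thesis using d(2)[of "(t, y)"] that by simp
  qed
  then show ?thesis using d(1) by (intro exI[of _ "d / 2"]) auto
qed

lemma has_jet_extinguishing:
  fixes c \<alpha> \<beta> \<gamma> s1 T \<eta> t0 y0 :: real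
  assumes t0: "t0 < T" and Y0: "0 < y0 * (T - t0) powr \<beta> + s1"
  defines "Y \<equiv> y0 * (T - t0) powr \<beta> + s1"
  shows "has_jet (\<lambda>t y. c * (T - t) powr \<alpha> * (y * (T - t) powr \<beta> + s1) powr (- \<gamma>) + \<eta> / (T - t)) t0 y0
    (- c * \<alpha> * (T - t0) powr (\<alpha> - 1) * Y powr (- \<gamma>)
       + c * \<gamma> * \<beta> * y0 * (T - t0) powr (\<alpha> + \<beta> - 1) * Y powr (- \<gamma> - 1) + \<eta> / (T - t0)\<^sup>2)
    (- c * \<gamma> * (T - t0) powr (\<alpha> + \<beta>) * Y powr (- \<gamma> - 1))
    (c * \<gamma> * (\<gamma> + 1) * (T - t0) powr (\<alpha> + 2 * \<beta>) * Y powr (- \<gamma> - 2))"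
proof -
  obtain d where d: "d > 0" "\<And>t y. \<bar>t - t0\<bar> < d \<Longrightarrow> \<bar>y - y0\<bar> < d \<Longrightarrow> t < T \<and> 0 < y * (T - t) powr \<beta> + s1"
    using front_domain[OF t0 Y0] by blast
  let ?ft = "\<lambda>t y. - c * \<alpha> * (T - t) powr (\<alpha> - 1) * (y * (T - t) powr \<beta> + s1) powr (- \<gamma>)
       + c * \<gamma> * \<beta> * y * (T - t) powr (\<alpha> + \<beta> - 1) * (y * (T - t) powr \<beta> + s1) powr (- \<gamma> - 1) + \<eta> / (T - t)\<^sup>2"
  let ?fy = "\<lambda>y. - c * \<gamma> * (T - t0) powr (\<alpha> + \<beta>) * (y * (T - t0) powr \<beta> + s1) powr (- \<gamma> - 1)"
  have dy: "((\<lambda>y. (y * (T - t0) powr \<beta> + s1) powr r) has_real_derivative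
      r * (T - t0) powr \<beta> * (y * (T - t0) powr \<beta> + s1) powr (r - 1)) (at y)"
    if "0 < y * (T - t0) powr \<beta> + s1" for r y
  proof -
    have "((\<lambda>y. (y * (T - t0) powr \<beta> + s1) powr r) has_real_derivative
      r * (y * (T - t0) powr \<beta> + s1) powr (r - real 1) * (T - t0) powr \<beta>) (at y)"
      using that by (intro DERIV_fun_powr) (auto intro!: derivative_eq_intros)
    then show ?thesis by (simp add: mult_ac)
  qed
  have "((\<lambda>t. c * (T - t) powr \<alpha> * (y * (T - t) powr \<beta> + s1) powr (- \<gamma>) + \<eta> / (T - t)) has_real_derivative ?ft t y) (at t)"
    if t: "t < T" and Y: "0 < y * (T - t) powr \<beta> + s1" for t y
  proof -
    have dp: "((\<lambda>t. (T - t) powr r) has_real_derivative - r * (T - t) powr (r - 1)) (at t)" for r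
    proof -
      have "((\<lambda>t. (T - t) powr r) has_real_derivative r * (T - t) powr (r - real 1) * (- 1)) (at t)"
        using t by (intro DERIV_fun_powr) (auto intro!: derivative_eq_intros)
      then show ?thesis by simp
    qed
    have "((\<lambda>t. (y * (T - t) powr \<beta> + s1) powr (- \<gamma>)) has_real_derivative
       - \<gamma> * (y * (T - t) powr \<beta> + s1) powr (- \<gamma> - real 1) * (y * (- \<beta> * (T - t) powr (\<beta> - 1)))) (at t)"
      by (intro DERIV_fun_powr Y) (use t in \<open>auto intro!: derivative_eq_intros dp\<close>)
    then have dY: "((\<lambda>t. (y * (T - t) powr \<beta> + s1) powr (- \<gamma>)) has_real_derivative
       \<gamma> * \<beta> * y * (T - t) powr (\<beta> - 1) * (y * (T - t) powr \<beta> + s1) powr (- \<gamma> - 1)) (at t)"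
      by (simp add: mult_ac)
    have "(T - t) powr \<alpha> * (T - t) powr (\<beta> - 1) = (T - t) powr (\<alpha> + \<beta> - 1)"
      by (simp flip: powr_add add: algebra_simps)
    then have e: "c * (T - t) powr \<alpha> * (\<gamma> * \<beta> * y * (T - t) powr (\<beta> - 1) * Z)
       = c * \<gamma> * \<beta> * y * (T - t) powr (\<alpha> + \<beta> - 1) * Z" for Z
      by (metis (no_types, opaque_lifting) mult.assoc mult.commute)
    have dE: "((\<lambda>t. \<eta> / (T - t)) has_real_derivative \<eta> / (T - t)\<^sup>2) (at t)"
      using t by (auto intro!: derivative_eq_intros simp: power2_eq_square)
    have "((\<lambda>t. c * (T - t) powr \<alpha> * (y * (T - t) powr \<beta> + s1) powr (- \<gamma>) + \<eta> / (T - t)) has_real_derivative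
        (c * (- \<alpha> * (T - t) powr (\<alpha> - 1)) * (y * (T - t) powr \<beta> + s1) powr (- \<gamma>)
         + \<gamma> * \<beta> * y * (T - t) powr (\<beta> - 1) * (y * (T - t) powr \<beta> + s1) powr (- \<gamma> - 1) * (c * (T - t) powr \<alpha>)) + \<eta> / (T - t)\<^sup>2) (at t)"
      by (intro DERIV_add DERIV_mult DERIV_cmult dp dY dE)
    then show ?thesis unfolding e[symmetric] by (simp add: mult_ac add_ac)
  qed
  moreover have "(\<lambda>(t, y). ?ft t y) differentiable (at (t0, y0))"
    unfolding differentiable_def case_prod_unfold
    by (intro exI) (use t0 Y0 in \<open>auto intro!: derivative_eq_intros\<close>)
  moreover have "((\<lambda>y. c * (T - t0) powr \<alpha> * (y * (T - t0) powr \<beta> + s1) powr (- \<gamma>) + \<eta> / (T - t0)) has_real_derivative ?fy y) (at y)"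
    if "0 < y * (T - t0) powr \<beta> + s1" for y
    by (rule derivative_eq_intros dy[OF that] refl)+ (simp add: powr_add)
  moreover have "(?fy has_real_derivative c * \<gamma> * (\<gamma> + 1) * (T - t0) powr (\<alpha> + 2 * \<beta>) * Y powr (- \<gamma> - 2)) (at y0)"
  proof -
    have "(?fy has_real_derivative (- c * \<gamma> * (T - t0) powr (\<alpha> + \<beta>)) * ((- \<gamma> - 1) * (T - t0) powr \<beta> * Y powr (- \<gamma> - 1 - 1))) (at y0)"
      unfolding Y_def by (rule DERIV_cmult[OF dy[OF Y0]])
    moreover have "(T - t0) powr (\<alpha> + 2 * \<beta>) = (T - t0) powr (\<alpha> + \<beta>) * (T - t0) powr \<beta>"
    proof -
      have "\<alpha> + 2 * \<beta> = (\<alpha> + \<beta>) + \<beta>" by simp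
      then show ?thesis by (simp only: powr_add)
    qed
    ultimately show ?thesis by (simp add: algebra_simps)
  qed
  ultimately show ?thesis
    unfolding has_jet_def using d t0
    by (intro exI[of _ ?ft] exI[of _ ?fy] exI[of _ d]) (auto simp: Y_def)
qed

text \<open>With \<open>\<alpha> = (p - q) / (p - 2 * q)\<close> and \<open>\<beta> = (q - p + 1) / (p - 2 * q)\<close> the function
  \<open>(T - t) powr \<alpha> * f (y * (T - t) powr \<beta>)\<close> is the self-similar form under which all three terms of
  the equation scale alike in time.\<close>

lemma extinguishing_strict_supersolution:
  fixes p q c s1 \<tau> y Y :: real
  assumes p: "1 < p" "p < 2" and q: "0 < q" "2 * q < p"
  defines "\<alpha> \<equiv> (p - q) / (p - 2 * q)"
  defines "\<beta> \<equiv> (q - p + 1) / (p - 2 * q)"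
  defines "\<gamma> \<equiv> q / (1 - q)"
  defines "\<delta> \<equiv> p + (p - 2) * \<gamma>"
  assumes c: "0 < c" and cq: "c * (\<alpha> + \<gamma> * \<bar>\<beta>\<bar>) \<le> (c * \<gamma>) powr q / 2"
    and s1: "0 < s1" "(p - 1) * (c * \<gamma>) powr (p - 1) * (\<gamma> + 1) * s1 powr (- \<delta>) < (c * \<gamma>) powr q / 2"
    and \<tau>: "0 < \<tau>" and y: "0 \<le> y" and Y: "Y = y * \<tau> powr \<beta> + s1"
  defines "b \<equiv> - c * \<gamma> * \<tau> powr (\<alpha> + \<beta>) * Y powr (- \<gamma> - 1)"
  defines "X \<equiv> c * \<gamma> * (\<gamma> + 1) * \<tau> powr (\<alpha> + 2 * \<beta>) * Y powr (- \<gamma> - 2)"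
  shows "(p - 1) * \<bar>b\<bar> powr (p - 2) * X - \<bar>b\<bar> powr q
     < - c * \<alpha> * \<tau> powr (\<alpha> - 1) * Y powr (- \<gamma>) + c * \<gamma> * \<beta> * y * \<tau> powr (\<alpha> + \<beta> - 1) * Y powr (- \<gamma> - 1)"
proof -
  have q1: "q < 1" using p q by simp
  have \<gamma>: "\<gamma> > 0" unfolding \<gamma>_def using q q1 by simp
  have pq: "p - 2 * q > 0" using q by simp
  have \<delta>: "\<delta> > 0"
  proof -
    have "(p * (1 - q) + (p - 2) * q) / (1 - q) > 0" using q q1 by (intro divide_pos_pos) (auto simp: algebra_simps)
    also have "(p * (1 - q) + (p - 2) * q) / (1 - q) = \<delta>"
      unfolding \<delta>_def \<gamma>_def using q1 by (simp add: field_simps)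
    finally show ?thesis .
  qed
  have \<alpha>\<beta>: "\<alpha> + \<beta> = 1 / (p - 2 * q)" unfolding \<alpha>_def \<beta>_def by (simp flip: add_divide_distrib)
  have Yp: "Y > 0" "Y \<ge> s1" unfolding Y using y s1 by (auto intro: add_nonneg_pos)
  \<comment> \<open>\<open>Z\<close> is the common scale: absorption equals (c \<gamma>)^q Z, the
    time derivative is at least -c (\<alpha> + \<gamma> |\<beta>|) Z, and diffusion is a multiple of
    Y^(-\<delta>) Z, where Y \<ge> s1.\<close>
  define Z where "Z = \<tau> powr (\<alpha> - 1) * Y powr (- \<gamma>)"
  have Z: "Z > 0" unfolding Z_def using \<tau> Yp by simp
  have b: "\<bar>b\<bar> = (c * \<gamma>) * \<tau> powr (\<alpha> + \<beta>) * Y powr (- \<gamma> - 1)"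
    unfolding b_def using c \<gamma> by (simp add: abs_mult)
  have bq: "\<bar>b\<bar> powr q = (c * \<gamma>) powr q * Z"
  proof -
    have "(\<alpha> + \<beta>) * q = \<alpha> - 1" unfolding \<alpha>\<beta> unfolding \<alpha>_def using pq by (simp add: field_simps)
    moreover have "(- \<gamma> - 1) * q = - \<gamma>" unfolding \<gamma>_def using q1 by (simp add: field_simps)
    ultimately show ?thesis unfolding b Z_def by (simp only: powr_mult powr_powr mult.assoc)
  qed
  have bX: "(p - 1) * \<bar>b\<bar> powr (p - 2) * X = (p - 1) * (c * \<gamma>) powr (p - 1) * (\<gamma> + 1) * Y powr (- \<delta>) * Z"
  proof -
    have e1: "(\<alpha> + \<beta>) * (p - 2) + (\<alpha> + 2 * \<beta>) = \<alpha> - 1"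
    proof -
      have "(\<alpha> + \<beta>) * (p - 2) + 2 * \<beta> = ((p - 2) + 2 * (q - p + 1)) / (p - 2 * q)"
        unfolding \<alpha>\<beta> unfolding \<beta>_def by (simp add: divide_inverse algebra_simps)
      also have "\<dots> = - 1" using pq by (simp add: field_simps)
      finally show ?thesis by simp
    qed
    have e2: "(- \<gamma> - 1) * (p - 2) + (- \<gamma> - 2) = - \<delta> + - \<gamma>" unfolding \<delta>_def by (simp add: algebra_simps)
    have e3: "(c * \<gamma>) powr (p - 2) * (c * \<gamma>) = (c * \<gamma>) powr (p - 1)"
      using c \<gamma> powr_add[of "c * \<gamma>" "p - 2" 1] by simp
    have "\<bar>b\<bar> powr (p - 2) * X = ((c * \<gamma>) powr (p - 2) * (c * \<gamma>)) * (\<gamma> + 1)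
       * (\<tau> powr ((\<alpha> + \<beta>) * (p - 2)) * \<tau> powr (\<alpha> + 2 * \<beta>))
       * (Y powr ((- \<gamma> - 1) * (p - 2)) * Y powr (- \<gamma> - 2))"
    proof -
      have "\<bar>b\<bar> powr (p - 2) = (c * \<gamma>) powr (p - 2) * \<tau> powr ((\<alpha> + \<beta>) * (p - 2)) * Y powr ((- \<gamma> - 1) * (p - 2))"
        unfolding b by (simp only: powr_mult powr_powr)
      then show ?thesis unfolding X_def by (simp only: mult_ac)
    qed
    also have "\<dots> = (c * \<gamma>) powr (p - 1) * (\<gamma> + 1) * \<tau> powr (\<alpha> - 1) * (Y powr (- \<delta>) * Y powr (- \<gamma>))"
      unfolding e3 powr_add[symmetric] e1 e2 ..
    finally show ?thesis unfolding Z_def by (simp add: mult_ac)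
  qed
  have "(p - 1) * (c * \<gamma>) powr (p - 1) * (\<gamma> + 1) * Y powr (- \<delta>) \<le> (p - 1) * (c * \<gamma>) powr (p - 1) * (\<gamma> + 1) * s1 powr (- \<delta>)"
    using p \<gamma> Yp s1 \<delta> by (intro mult_left_mono powr_mono2') auto
  then have "(p - 1) * (c * \<gamma>) powr (p - 1) * (\<gamma> + 1) * Y powr (- \<delta>) < (c * \<gamma>) powr q / 2"
    using s1(2) by linarith
  then have D: "(p - 1) * \<bar>b\<bar> powr (p - 2) * X < (c * \<gamma>) powr q / 2 * Z"
    unfolding bX using Z by (rule mult_strict_right_mono)
  \<comment> \<open>The sign of \<beta> is that of q - p + 1 and may be either, so the term is
    estimated in modulus.\<close>
  have "\<bar>c * \<gamma> * \<beta> * y * \<tau> powr (\<alpha> + \<beta> - 1) * Y powr (- \<gamma> - 1)\<bar> \<le> c * \<gamma> * \<bar>\<beta>\<bar> * Z"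
  proof -
    have e: "y * \<tau> powr (\<alpha> + \<beta> - 1) * Y powr (- \<gamma> - 1) = (y * \<tau> powr \<beta> / Y) * Z"
    proof -
      have "\<tau> powr (\<alpha> + \<beta> - 1) = \<tau> powr \<beta> * \<tau> powr (\<alpha> - 1)" by (simp flip: powr_add add: algebra_simps)
      moreover have "Y powr (- \<gamma> - 1) = Y powr (- \<gamma>) / Y" using Yp powr_diff[of Y "- \<gamma>" 1] by simp
      ultimately show ?thesis unfolding Z_def by simp
    qed
    have "\<bar>c * \<gamma> * \<beta> * y * \<tau> powr (\<alpha> + \<beta> - 1) * Y powr (- \<gamma> - 1)\<bar> = c * \<gamma> * \<bar>\<beta>\<bar> * (y * \<tau> powr \<beta> / Y * Z)"
      unfolding e[symmetric] using c \<gamma> y by (simp add: abs_mult mult_ac)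
    also have "\<dots> \<le> c * \<gamma> * \<bar>\<beta>\<bar> * (1 * Z)"
    proof -
      have "y * \<tau> powr \<beta> / Y \<le> 1" using Yp s1 unfolding Y by simp
      then show ?thesis using c \<gamma> Z by (intro mult_left_mono mult_right_mono) auto
    qed
    finally show ?thesis by simp
  qed
  then have "- (c * (\<alpha> + \<gamma> * \<bar>\<beta>\<bar>) * Z) \<le> - c * \<alpha> * \<tau> powr (\<alpha> - 1) * Y powr (- \<gamma>) + c * \<gamma> * \<beta> * y * \<tau> powr (\<alpha> + \<beta> - 1) * Y powr (- \<gamma> - 1)"
    unfolding Z_def by (simp add: algebra_simps abs_le_iff)
  moreover have "c * (\<alpha> + \<gamma> * \<bar>\<beta>\<bar>) * Z \<le> (c * \<gamma>) powr q / 2 * Z"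
    using cq Z by (intro mult_right_mono) auto
  moreover have "(c * \<gamma>) powr q * Z = (c * \<gamma>) powr q / 2 * Z + (c * \<gamma>) powr q / 2 * Z" by simp
  ultimately show ?thesis using D unfolding bq by linarith
qed

context radial_profile
begin

text \<open>\<open>cq\<close> lets half of the absorption cover the decrease of the barrier in time,
  the bound on \<open>s1\<close> lets the other half cover diffusion, and the conditions on
  \<open>T\<close> put the barrier above the data at time 0.\<close>

lemma extinction_at_time:
  fixes u0 :: "real^'n \<Rightarrow> real" and q :: real
  assumes q: "0 < q" "2 * q < p" and sol: "cauchy_sol p q u0 u"
  defines "\<alpha> \<equiv> (p - q) / (p - 2 * q)"
  defines "\<beta> \<equiv> (q - p + 1) / (p - 2 * q)"
  defines "\<gamma> \<equiv> q / (1 - q)"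
  defines "\<delta> \<equiv> p + (p - 2) * \<gamma>"
  assumes tail: "\<And>x. u0 x \<le> C0 * (1 + norm x) powr (- \<gamma>)" and C0: "0 < C0"
    and c: "0 < c" and cq: "c * (\<alpha> + \<gamma> * \<bar>\<beta>\<bar>) \<le> (c * \<gamma>) powr q / 2"
    and s1: "0 < s1" "(p - 1) * (c * \<gamma>) powr (p - 1) * (\<gamma> + 1) * s1 powr (- \<delta>) < (c * \<gamma>) powr q / 2"
    and T: "0 < T" "C0 \<le> c * T powr \<alpha> * (T powr \<beta>) powr (- \<gamma>)" "C0 \<le> c * T powr \<alpha> * s1 powr (- \<gamma>)"
  shows "u T x = 0"
proof -
  have q1: "q < 1" using p2 q by simp
  have \<gamma>: "\<gamma> > 0" unfolding \<gamma>_def using q q1 by simp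
  have \<alpha>: "\<alpha> > 0" unfolding \<alpha>_def using q by simp
  have cont: "continuous_on ({0..} \<times> UNIV) (\<lambda>(t,x). u t x)" and nn: "\<And>t x. t \<ge> 0 \<Longrightarrow> u t x \<ge> 0"
    and u0: "\<And>x. u 0 x = u0 x" and sub: "visc_subsol p q {0<..} u"
    using sol unfolding cauchy_sol_def visc_sol_def by auto
  have tail0: "(u 0 \<longlongrightarrow> 0) at_infinity"
  proof (rule tendsto_sandwich[where f = "\<lambda>_. 0" and h = "\<lambda>x. C0 * (1 + norm x) powr (- \<gamma>)"])
    have "LIM x at_infinity. 1 + norm (x::real^'n) :> at_top"
      by (rule filterlim_tendsto_add_at_top[OF tendsto_const filterlim_norm_at_top])
    then have "((\<lambda>x::real^'n. C0 * (1 + norm x) powr (- \<gamma>)) \<longlongrightarrow> C0 * 0) at_infinity"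
      using \<gamma> by (intro tendsto_mult_left tendsto_neg_powr) auto
    then show "((\<lambda>x::real^'n. C0 * (1 + norm x) powr (- \<gamma>)) \<longlongrightarrow> 0) at_infinity" by simp
  qed (use u0 tail nn[of 0] in auto)
  have init: "u0 x \<le> c * T powr \<alpha> * (norm x * T powr \<beta> + s1) powr (- \<gamma>)" for x
  proof -
    \<comment> \<open>Since |x| T^\<beta> + s1 \<le> m (1 + |x|), the ordering at time 0 follows
      from the two conditions on C0, one for each value of the maximum.\<close>
    define m where "m = max (T powr \<beta>) s1"
    have m: "m > 0" unfolding m_def using s1 by simp
    have "C0 \<le> c * T powr \<alpha> * m powr (- \<gamma>)" unfolding m_def max_def using T by simp
    then have "C0 * (1 + norm x) powr (- \<gamma>) \<le> c * T powr \<alpha> * m powr (- \<gamma>) * (1 + norm x) powr (- \<gamma>)"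
      by (intro mult_right_mono) auto
    also have "\<dots> = c * T powr \<alpha> * (m * (1 + norm x)) powr (- \<gamma>)"
      by (simp only: powr_mult mult.assoc)
    also have "\<dots> \<le> c * T powr \<alpha> * (norm x * T powr \<beta> + s1) powr (- \<gamma>)"
    proof (intro mult_left_mono powr_mono2')
      have "norm x * T powr \<beta> \<le> norm x * m" by (intro mult_left_mono) (auto simp: m_def)
      moreover have "s1 \<le> m" unfolding m_def by simp
      ultimately show "norm x * T powr \<beta> + s1 \<le> m * (1 + norm x)" by (simp add: algebra_simps)
      show "0 < norm x * T powr \<beta> + s1" using s1 by (intro add_nonneg_pos) auto
    qed (use c \<gamma> in auto)
    finally show ?thesis using tail[of x] by simp
  qed
  have bound: "u t x \<le> c * (T - t) powr \<alpha> * (norm x * (T - t) powr \<beta> + s1) powr (- \<gamma>)"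
    if t: "0 \<le> t" "t < T" for t x
  proof (rule ccontr)
    assume neg: "\<not> ?thesis"
    define \<eta> where "\<eta> = (u t x - c * (T - t) powr \<alpha> * (norm x * (T - t) powr \<beta> + s1) powr (- \<gamma>)) / 2 * (T - t)"
    have \<eta>: "\<eta> > 0" unfolding \<eta>_def using neg t by simp
    define \<phi> where "\<phi> = (\<lambda>t y. c * (T - t) powr \<alpha> * (y * (T - t) powr \<beta> + s1) powr (- \<gamma>) + \<eta> / (T - t))"
    define w where "w = (\<lambda>t x. u t x - \<phi> t (norm x))"
    have wt: "w t x > 0"
    proof -
      have "\<eta> / (T - t) = (u t x - c * (T - t) powr \<alpha> * (norm x * (T - t) powr \<beta> + s1) powr (- \<gamma>)) / 2"
        unfolding \<eta>_def using t by (intro nonzero_mult_div_cancel_right) simp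
      then show ?thesis unfolding w_def \<phi>_def using neg by (simp add: field_simps)
    qed
    \<comment> \<open>The barrier itself tends to 0 at infinity. There it is the penalty, at least
      \<eta> / T, that exceeds u, thanks to the uniform decay.\<close>
    have "\<eta> / T > 0" using \<eta> T by simp
    then obtain \<rho> where \<rho>: "\<And>s y. 0 \<le> s \<Longrightarrow> s \<le> T \<Longrightarrow> \<rho> \<le> norm y \<Longrightarrow> u s y \<le> \<eta> / T"
      using uniform_decay[OF sub cont tail0 T(1)] by blast
    obtain K where K: "K > 0" "\<And>s y. 0 \<le> s \<Longrightarrow> s \<le> T \<Longrightarrow> norm y \<le> \<rho> \<Longrightarrow> u s y < K"
    proof -
      have "compact ((\<lambda>(t,x). u t x) ` ({0..T} \<times> cball 0 \<rho>))"
        by (intro compact_continuous_image compact_Times compact_cball compact_Icc continuous_on_subset[OF cont]) auto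
      then obtain B where B: "\<And>z. z \<in> {0..T} \<times> cball 0 \<rho> \<Longrightarrow> norm ((\<lambda>(t,x). u t x) z) \<le> B"
        using compact_imp_bounded bounded_iff by (metis (no_types, lifting) imageI)
      have "u s y < max 1 (B + 1)" if "0 \<le> s" "s \<le> T" "norm y \<le> \<rho>" for s y
        using B[of "(s, y)"] that by auto
      then show ?thesis using that[of "max 1 (B + 1)"] by auto
    qed
    define \<tau> where "\<tau> = \<eta> / K"
    have \<tau>: "\<tau> > 0" unfolding \<tau>_def using \<eta> K by simp
    define S where "S = {0..T - \<tau>} \<times> cball (0::real^'n) \<rho>"
    have far: "w s y \<le> 0" if s: "0 \<le> s" "s < T" and nS: "(s, y) \<notin> S" for s y
    proof -
      have p0: "c * (T - s) powr \<alpha> * (norm y * (T - s) powr \<beta> + s1) powr (- \<gamma>) \<ge> 0" using c by simp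
      show ?thesis
      proof (cases "norm y \<le> \<rho>")
        case True
        then have "s > T - \<tau>" using nS s unfolding S_def by auto
        then have "\<eta> / (T - s) > K" unfolding \<tau>_def using K s \<eta> by (simp add: field_simps)
        then show ?thesis unfolding w_def \<phi>_def using p0 K(2)[of s y] s True by simp
      next
        case False
        then have "u s y \<le> \<eta> / T" using \<rho>[of s y] s by simp
        also have "\<eta> / T \<le> \<eta> / (T - s)" using \<eta> s by (intro divide_left_mono) auto
        finally show ?thesis unfolding w_def \<phi>_def using p0 by simp
      qed
    qed
    have tS: "(t, x) \<in> S" using far[of t x] wt t by fastforce
    have S01: "0 \<le> s \<and> s < T" if "(s, y) \<in> S" for s y using that \<tau> unfolding S_def by auto
    have compS: "compact S" unfolding S_def by (intro compact_Times compact_Icc compact_cball)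
    have "continuous_on S (\<lambda>z. (case z of (t,x) \<Rightarrow> u t x)
        - (c * (T - fst z) powr \<alpha> * (norm (snd z) * (T - fst z) powr \<beta> + s1) powr (- \<gamma>) + \<eta> / (T - fst z)))"
    proof -
      have "T - fst z \<noteq> 0" "norm (snd z) * (T - fst z) powr \<beta> + s1 \<noteq> 0" if "z \<in> S" for z
      proof -
        show "T - fst z \<noteq> 0" using S01[of "fst z" "snd z"] that by simp
        have "norm (snd z) * (T - fst z) powr \<beta> + s1 > 0" using s1 by (intro add_nonneg_pos) auto
        then show "norm (snd z) * (T - fst z) powr \<beta> + s1 \<noteq> 0" by simp
      qed
      moreover have "S \<subseteq> {0..} \<times> UNIV" unfolding S_def by auto
      ultimately show ?thesis
        by (intro continuous_intros continuous_on_subset[OF cont]) auto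
    qed
    then have "continuous_on S (\<lambda>z. w (fst z) (snd z))" unfolding w_def \<phi>_def by (simp add: case_prod_unfold)
    from continuous_attains_sup[OF compS _ this] tS obtain t0 x0 where S0: "(t0, x0) \<in> S"
      and maxS: "\<And>s y. (s, y) \<in> S \<Longrightarrow> w s y \<le> w t0 x0" by fastforce
    have w0: "w t0 x0 > 0" using maxS[OF tS] wt by simp
    have max: "w s y \<le> w t0 x0" if "0 \<le> s" "s < T" for s y
      using maxS[of s y] far[OF that, of y] w0 by fastforce
    have t0: "0 \<le> t0" "t0 < T" using S01[OF S0] by auto
    have t00: "t0 > 0"
    proof (rule ccontr)
      assume "\<not> t0 > 0"
      then have "t0 = 0" using t0 by simp
      then have "u0 x0 > c * T powr \<alpha> * (norm x0 * T powr \<beta> + s1) powr (- \<gamma>)"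
        using w0 \<open>\<eta> / T > 0\<close> unfolding w_def \<phi>_def by (simp add: u0)
      then show False using init[of x0] by simp
    qed
    obtain e :: "real^'n" where e: "norm e = 1" using vector_choose_size[of 1] by auto
    \<comment> \<open>At the origin every unit vector satisfies x0 \<bullet> v = |x0|, so an
      arbitrary one is taken.\<close>
    define v where "v = (if x0 = 0 then e else x0 /\<^sub>R norm x0)"
    have v: "norm v = 1" unfolding v_def using e by simp
    have xv: "x0 \<bullet> v = norm x0" unfolding v_def by (auto simp: dot_square_norm power2_eq_square)
    have vle: "y \<bullet> v \<le> norm y" for y using norm_cauchy_schwarz[of y v] v by simp
    define Y where "Y = norm x0 * (T - t0) powr \<beta> + s1"
    have Y: "Y > 0" unfolding Y_def using s1 by (intro add_nonneg_pos) auto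
    obtain d where d: "d > 0" "\<And>s y. \<bar>s - t0\<bar> < d \<Longrightarrow> \<bar>y - norm x0\<bar> < d \<Longrightarrow> s < T \<and> 0 < y * (T - s) powr \<beta> + s1"
      using front_domain[OF t0(2) Y[unfolded Y_def]] by blast
    define a where "a = - c * \<alpha> * (T - t0) powr (\<alpha> - 1) * Y powr (- \<gamma>)
       + c * \<gamma> * \<beta> * norm x0 * (T - t0) powr (\<alpha> + \<beta> - 1) * Y powr (- \<gamma> - 1) + \<eta> / (T - t0)\<^sup>2"
    define b where "b = - c * \<gamma> * (T - t0) powr (\<alpha> + \<beta>) * Y powr (- \<gamma> - 1)"
    define X where "X = c * \<gamma> * (\<gamma> + 1) * (T - t0) powr (\<alpha> + 2 * \<beta>) * Y powr (- \<gamma> - 2)"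
    have b: "b \<noteq> 0" unfolding b_def using c \<gamma> t0 Y by simp
    have jet: "has_jet \<phi> t0 (x0 \<bullet> v) a b X"
      using has_jet_extinguishing[OF t0(2) Y[unfolded Y_def], of c \<alpha> \<gamma> \<eta>]
      unfolding \<phi>_def a_def b_def X_def Y_def xv .
    have "loc_max_at {0<..} (\<lambda>t x. u t x - \<phi> t (x \<bullet> v)) t0 x0"
      unfolding loc_max_at_def
    proof (intro exI[of _ d] conjI allI impI)
      fix s y assume sy: "s \<in> {0<..} \<and> \<bar>s - t0\<bar> < d \<and> norm (y - x0) < d"
      have "\<bar>y \<bullet> v - norm x0\<bar> \<le> norm (y - x0)"
        using Cauchy_Schwarz_ineq2[of "y - x0" v] v xv by (simp add: inner_diff_left)
      then have "s < T" and pos: "0 < (y \<bullet> v) * (T - s) powr \<beta> + s1"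
        using d(2)[of s "y \<bullet> v"] sy by auto
      have "(norm y * (T - s) powr \<beta> + s1) powr (- \<gamma>) \<le> ((y \<bullet> v) * (T - s) powr \<beta> + s1) powr (- \<gamma>)"
        using pos \<gamma> vle[of y] by (intro powr_mono2') (auto intro!: mult_right_mono)
      then have "\<phi> s (norm y) \<le> \<phi> s (y \<bullet> v)"
        unfolding \<phi>_def using c by (auto intro!: mult_left_mono)
      then show "u s y - \<phi> s (y \<bullet> v) \<le> u t0 x0 - \<phi> t0 (x0 \<bullet> v)"
        using max[of s y] sy \<open>s < T\<close> unfolding w_def xv by auto
    qed (rule d)
    from subsol_planar[OF sub t00 v jet b this]
    have "a \<le> (p - 1) * \<bar>b\<bar> powr (p - 2) * X - \<bar>b\<bar> powr q" .
    moreover have "(p - 1) * \<bar>b\<bar> powr (p - 2) * X - \<bar>b\<bar> powr q < a - \<eta> / (T - t0)\<^sup>2"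
      unfolding a_def b_def X_def add_diff_cancel_right' \<alpha>_def \<beta>_def \<gamma>_def
      by (rule extinguishing_strict_supersolution[OF p1 p2 q c cq[unfolded \<alpha>_def \<beta>_def \<gamma>_def] s1(1)
            s1(2)[unfolded \<delta>_def \<gamma>_def] _ norm_ge_zero Y_def[unfolded \<beta>_def]])
        (use t0 in simp)
    moreover have "\<eta> / (T - t0)\<^sup>2 > 0" using \<eta> t0 by simp
    ultimately show False by linarith
  qed
  \<comment> \<open>As \<alpha> > 0, the bound valid for t < T tends to 0 as t approaches T;
    continuity of u carries it to time T.\<close>
  have "u T x \<le> 0"
  proof (rule tendsto_le[where F = "at_left T"])
    have "continuous_on {0..} (\<lambda>t. (\<lambda>(t,x). u t x) (t, x))"
      by (rule continuous_on_compose2[OF cont]) (auto intro!: continuous_intros)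
    then have "continuous_on {0..} (\<lambda>t. u t x)" by simp
    then have "isCont (\<lambda>t. u t x) T"
      using T continuous_on_interior[of "{0..}" "\<lambda>t. u t x" T] by (simp add: interior_Ici)
    then show "((\<lambda>t. u t x) \<longlongrightarrow> u T x) (at_left T)"
      unfolding isCont_def by (rule tendsto_within_subset) auto
    have "((\<lambda>t. c * (T - t) powr \<alpha> * s1 powr (- \<gamma>)) \<longlongrightarrow> c * 0 * s1 powr (- \<gamma>)) (at_left T)"
    proof (intro tendsto_mult tendsto_const tendsto_zero_powrI)
      have "((\<lambda>t. T - t) \<longlongrightarrow> T - T) (at_left T)" by (intro tendsto_intros)
      then show "((\<lambda>t. T - t) \<longlongrightarrow> 0) (at_left T)" by simp
      show "\<forall>\<^sub>F t in at_left T. 0 \<le> T - t" by (auto simp: eventually_at_filter)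
    qed (use \<alpha> in auto)
    then show "((\<lambda>t. c * (T - t) powr \<alpha> * s1 powr (- \<gamma>)) \<longlongrightarrow> 0) (at_left T)" by simp
    have "\<forall>\<^sub>F t in at_left T. 0 < t \<and> t < T"
      using T unfolding eventually_at_left_field by (intro exI[of _ 0]) auto
    then show "\<forall>\<^sub>F t in at_left T. u t x \<le> c * (T - t) powr \<alpha> * s1 powr (- \<gamma>)"
    proof eventually_elim
      case (elim t)
      have "u t x \<le> c * (T - t) powr \<alpha> * (norm x * (T - t) powr \<beta> + s1) powr (- \<gamma>)"
        using bound elim by simp
      also have "\<dots> \<le> c * (T - t) powr \<alpha> * s1 powr (- \<gamma>)"
        using c s1 \<gamma> by (intro mult_left_mono powr_mono2') auto
      finally show ?case .
    qed
  qed simp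
  then show ?thesis using nn[of T x] T by simp
qed

text \<open>The conditions on the terminal time hold for every T \<ge> T0, so each later time has
  its own barrier vanishing then. This gives u = 0 at all times from T0 on without restarting the
  problem.\<close>

lemma finite_time_extinction:
  fixes u0 :: "real^'n \<Rightarrow> real" and q :: real
  assumes q: "0 < q" "2 * q < p" and sol: "cauchy_sol p q u0 u" and C0: "0 < C0"
    and tail: "\<And>x. u0 x \<le> C0 * (1 + norm x) powr (- q / (1 - q))"
  shows "\<exists>T0. \<forall>T\<ge>T0. \<forall>x. u T x = 0"
proof -
  define \<alpha> where "\<alpha> = (p - q) / (p - 2 * q)"
  define \<beta> where "\<beta> = (q - p + 1) / (p - 2 * q)"
  define \<gamma> where "\<gamma> = q / (1 - q)"
  define \<delta> where "\<delta> = p + (p - 2) * \<gamma>"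
  have q1: "q < 1" using p2 q by simp
  have \<gamma>: "\<gamma> > 0" unfolding \<gamma>_def using q q1 by simp
  have \<alpha>: "\<alpha> > 0" unfolding \<alpha>_def using q by simp
  have \<delta>: "\<delta> > 0"
  proof -
    have "(p * (1 - q) + (p - 2) * q) / (1 - q) > 0" using q q1 by (intro divide_pos_pos) (auto simp: algebra_simps)
    also have "(p * (1 - q) + (p - 2) * q) / (1 - q) = \<delta>"
      unfolding \<delta>_def \<gamma>_def using q1 by (simp add: field_simps)
    finally show ?thesis .
  qed
  \<comment> \<open>The power of T in the first condition on C0: it is positive whatever the sign of
    \<beta>, so large T satisfies the condition.\<close>
  have \<alpha>\<beta>\<gamma>: "\<alpha> - \<beta> * \<gamma> = 1 / (1 - q)"
  proof -
    have "\<alpha> - \<beta> * \<gamma> = ((p - q) * (1 - q) - (q - p + 1) * q) / ((p - 2 * q) * (1 - q))"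
      unfolding \<alpha>_def \<beta>_def \<gamma>_def using q q1 by (simp add: diff_divide_distrib)
    also have "(p - q) * (1 - q) - (q - p + 1) * q = (p - 2 * q) * 1" by (simp add: algebra_simps)
    also have "\<dots> / ((p - 2 * q) * (1 - q)) = 1 / (1 - q)" using q by (intro mult_divide_mult_cancel_left) simp
    finally show ?thesis .
  qed
  have tail': "u0 x \<le> C0 * (1 + norm x) powr (- (q / (1 - q)))" for x
    using tail[of x] by (simp only: minus_divide_left)
  define \<kappa> where "\<kappa> = \<alpha> + \<gamma> * \<bar>\<beta>\<bar>"
  have \<kappa>: "\<kappa> > 0" unfolding \<kappa>_def using \<alpha> \<gamma> by (simp add: add_pos_nonneg)
  \<comment> \<open>\<open>c\<close> solves c \<kappa> = (c \<gamma>)^q / 2, which is possible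
    because q < 1.\<close>
  define c where "c = (\<gamma> powr q / (2 * \<kappa>)) powr (1 / (1 - q))"
  have c: "c > 0" unfolding c_def using \<gamma> \<kappa> by simp
  have cq: "c * \<kappa> \<le> (c * \<gamma>) powr q / 2"
  proof -
    have "c = c powr (1 - q) * c powr q" using c by (simp flip: powr_add)
    also have "c powr (1 - q) = \<gamma> powr q / (2 * \<kappa>)" unfolding c_def using q1 \<gamma> \<kappa> by (simp add: powr_powr)
    finally have "c * \<kappa> = \<gamma> powr q / (2 * \<kappa>) * c powr q * \<kappa>" by (rule arg_cong)
    also have "\<dots> = (c * \<gamma>) powr q / 2" using \<kappa> by (simp add: powr_mult)
    finally show ?thesis by simp
  qed
  have ev: "\<exists>s>0. A * s powr (- r) < B" if "r > 0" "B > 0" for A r B :: real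
  proof -
    have "((\<lambda>s. A * s powr (- r)) \<longlongrightarrow> A * 0) at_top"
      by (intro tendsto_mult_left tendsto_neg_powr) (use that in \<open>auto intro: filterlim_ident\<close>)
    then have "\<forall>\<^sub>F s in at_top. A * s powr (- r) < B" by (rule order_tendstoD) (use that in auto)
    then have "\<forall>\<^sub>F s in at_top. s > 0 \<and> A * s powr (- r) < B"
      using eventually_gt_at_top[of "0::real"] by eventually_elim auto
    from eventually_happens'[OF trivial_limit_at_top_linorder this] show ?thesis by blast
  qed
  obtain s1 where s1: "s1 > 0" "(p - 1) * (c * \<gamma>) powr (p - 1) * (\<gamma> + 1) * s1 powr (- \<delta>) < (c * \<gamma>) powr q / 2"
    using ev[OF \<delta>, of "(c * \<gamma>) powr q / 2"] c \<gamma> by auto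
  have large: "B \<le> T powr r" if "r > 0" "(max 1 B) powr (1 / r) \<le> T" for B r T :: real
  proof -
    have "max 1 B = ((max 1 B) powr (1 / r)) powr r" using that(1) by (simp add: powr_powr)
    also have "\<dots> \<le> T powr r" using that by (intro powr_mono2) auto
    finally show ?thesis by simp
  qed
  define T0 where "T0 = max 1 (max ((max 1 (C0 / c)) powr (1 / (1 / (1 - q))))
    ((max 1 (C0 / (c * s1 powr (- \<gamma>)))) powr (1 / \<alpha>)))"
  have T0: "0 < T \<and> C0 / c \<le> T powr (1 / (1 - q)) \<and> C0 / (c * s1 powr (- \<gamma>)) \<le> T powr \<alpha>" if "T \<ge> T0" for T
    using that q1 \<alpha> unfolding T0_def by (intro conjI large) auto
  have "u T x = 0" if "T \<ge> T0" for T x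
  proof -
    have T: "0 < T" "C0 / c \<le> T powr (1 / (1 - q))" "C0 / (c * s1 powr (- \<gamma>)) \<le> T powr \<alpha>"
      using T0[OF that] by auto
    have "C0 \<le> c * T powr (1 / (1 - q))" using T(2) c by (simp add: field_simps)
    also have "T powr (1 / (1 - q)) = T powr \<alpha> * (T powr \<beta>) powr (- \<gamma>)"
      unfolding \<alpha>\<beta>\<gamma>[symmetric] by (simp add: powr_powr flip: powr_add)
    finally have T1: "C0 \<le> c * T powr \<alpha> * (T powr \<beta>) powr (- \<gamma>)" by (simp add: mult.assoc)
    have T2: "C0 \<le> c * T powr \<alpha> * s1 powr (- \<gamma>)" using T(3) c s1 by (simp add: field_simps)
    show ?thesis
      using tail' C0 c cq s1 T(1) T1 T2 unfolding \<alpha>_def \<beta>_def \<gamma>_def \<delta>_def \<kappa>_def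
      by (rule extinction_at_time[OF q sol])
  qed
  then show ?thesis by blast
qed

end

section \<open>Extinction time and conclusion\<close>

text \<open>Time 0 alone would only show that the supremum is nonnegative; continuity in time keeps
  u nonzero at \<open>x\<close> up to a positive time.\<close>

lemma extinction_time_pos:
  assumes cont: "continuous_on ({0..} \<times> UNIV) (\<lambda>(t,x). u t x)" and nz: "u 0 x \<noteq> 0"
  shows "0 < extinction_time u"
proof -
  have "continuous_on {0..} (\<lambda>t. (\<lambda>(t,x). u t x) (t, x))"
    by (rule continuous_on_compose2[OF cont]) (auto intro!: continuous_intros)
  then have "((\<lambda>t. u t x) \<longlongrightarrow> u 0 x) (at 0 within {0..})" by (simp add: continuous_on_def)
  then have "\<forall>\<^sub>F t in at 0 within {0..}. u t x \<noteq> 0" using nz by (rule tendsto_imp_eventually_ne)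
  then obtain d where d: "d > 0" "\<And>t. t \<in> {0..} \<Longrightarrow> t \<noteq> 0 \<Longrightarrow> dist t 0 < d \<Longrightarrow> u t x \<noteq> 0"
    unfolding eventually_at by blast
  have "u (d / 2) x \<noteq> 0" using d by auto
  then have "ereal (d / 2) \<le> extinction_time u"
    unfolding extinction_time_def using d(1) by (intro Sup_upper CollectI exI[of _ "d / 2"]) auto
  then show ?thesis using d(1) by (metis ereal_less(2) half_gt_zero less_le_trans)
qed

theorem theorem1p1:
  fixes p q :: real and u0 :: "real^'n \<Rightarrow> real" and u :: "real \<Rightarrow> real^'n \<Rightarrow> real"
  assumes p_lo: "2 * real CARD('n) / (real CARD('n) + 1) < p" and p_hi: "p < 2"
    and q_pos: "0 < q" and q_hi: "q < p / 2"
    and u0_L1: "integrable lborel u0"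
    and u0_bdd: "bounded (range u0)"
    and u0_lip: "\<exists>L. lipschitz_on L UNIV u0"
    and u0_nonneg: "\<forall>x. u0 x \<ge> 0"
    and u0_nonzero: "\<exists>x. u0 x \<noteq> 0"
    and sol: "cauchy_sol p q u0 u"
  shows "((\<exists>C0>0. \<forall>x. u0 x \<le> C0 * (1 + norm x) powr (- q / (1 - q)))
            \<longrightarrow> 0 < extinction_time u \<and> extinction_time u < \<infinity>)
       \<and> ((filterlim (\<lambda>x. norm x powr (q / (1 - q)) * u0 x) at_top at_infinity \<and> (\<forall>x. u0 x > 0))
            \<longrightarrow> extinction_time u = \<infinity> \<and> (\<forall>t>0. positivity_set u t = UNIV))"
proof -
  \<comment> \<open>The dimension is at least 1, so the lower bound on p yields p > 1.\<close>
  have "1 \<le> 2 * real CARD('n) / (real CARD('n) + 1)"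
    using zero_less_card_finite[where 'a='n] by (simp add: field_simps flip: Suc_le_eq)
  then have p1: "1 < p" using p_lo by (rule le_less_trans)
  obtain j :: nat where "real j > 1 / (p - 1) + 1" using reals_Archimedean2 by blast
  then have "(2 * real j - 1) * (p - 1) > 1"
  proof -
    assume j: "real j > 1 / (p - 1) + 1"
    have "1 / (p - 1) > 0" using p1 by simp
    then have "2 * real j - 1 > 1 / (p - 1)" using j by linarith
    then show ?thesis using p1 by (simp add: field_simps)
  qed
  then interpret radial_profile p j by unfold_locales (use p1 p_hi in auto)
  have q2: "2 * q < p" using q_hi by simp
  have cont: "continuous_on ({0..} \<times> UNIV) (\<lambda>(t,x). u t x)" and u0: "\<And>x. u 0 x = u0 x"
    using sol unfolding cauchy_sol_def by auto
  have "0 < extinction_time u \<and> extinction_time u < \<infinity>"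
    if tail: "\<exists>C0>0. \<forall>x. u0 x \<le> C0 * (1 + norm x) powr (- q / (1 - q))"
  proof
    show "0 < extinction_time u" using extinction_time_pos[OF cont] u0_nonzero u0 by auto
    obtain C0 where C0: "0 < C0" "\<And>x. u0 x \<le> C0 * (1 + norm x) powr (- q / (1 - q))"
      using tail by blast
    from finite_time_extinction[OF q_pos q2 sol C0]
    obtain T0 where T0: "\<forall>T\<ge>T0. \<forall>x. u T x = 0" ..
    have "extinction_time u \<le> ereal T0"
      unfolding extinction_time_def
    proof (rule Sup_least)
      fix z assume "z \<in> {ereal t |t. 0 \<le> t \<and> (\<exists>x. u t x \<noteq> 0)}"
      then obtain t x where z: "z = ereal t" "u t x \<noteq> 0" by blast
      then have "\<not> T0 \<le> t" using T0 by blast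
      then show "z \<le> ereal T0" unfolding z by simp
    qed
    then show "extinction_time u < \<infinity>" by (rule le_less_trans) simp
  qed
  moreover have "extinction_time u = \<infinity> \<and> (\<forall>t>0. positivity_set u t = UNIV)"
    if *: "filterlim (\<lambda>x. norm x powr (q / (1 - q)) * u0 x) at_top at_infinity" "\<forall>x. u0 x > 0"
  proof -
    have pos: "u t x > 0" if "0 \<le> t" for t x
      using positivity_of_slow_decay[OF q_pos q2 sol *(1) _ that] *(2) by blast
    have "extinction_time u = \<infinity>"
    proof (rule ereal_top)
      fix B :: real
      \<comment> \<open>Positivity at the origin at time \<open>max B 0\<close>; the maximum keeps
        the time nonnegative.\<close>
      have "ereal (max B 0) \<le> extinction_time u"
        unfolding extinction_time_def using less_imp_neq[OF pos[of "max B 0" 0]]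
        by (intro Sup_upper CollectI exI[of _ "max B 0"]) auto
      then show "ereal B \<le> extinction_time u" by (rule order_trans[rotated]) simp
    qed
    then show ?thesis using pos unfolding positivity_set_def by auto
  qed
  ultimately show ?thesis by blast
qed

end
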